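(* Let $K$ be an $(\mathbb{F}_q,\mathbb{Z})$-field, $\mathcal{L}$ a language expanding $\mathcal{L}_{\mathrm{dist}}$, and $\Delta$ a collection of functions that are order-definable in $\mathcal{L}$. Let $A_1,A_2\subseteq K^{k+1}$ be $(\mathcal{L},\Delta)$-cells with centers $c_1$, resp. $c_2$. Then there is a collection $\Delta'$ of functions order-definable in $\mathcal{L}$ such that $A_1\cap A_2$ can be written as a finite union of pairwise disjoint $(\mathcal{L},\Delta')$-cells, each of which has center $c_1$ or $c_2$.
   Context: Let $K$ be an $(\mathbb{F}_q,\mathbb{Z})$-field: a valued field with residue field isomorphic to $\mathbb{F}_q$ and value group elementarily equivalent to $\mathbb{Z}$. Notation: $\mathrm{ord}$ is the valuation ($\mathrm{ord}\,0=+\infty$), $\mathcal{O}_K$ the valuation ring, $\mathcal{M}_K$ its maximal ideal, $\pi_K$ an element of smallest positive order; integers $\ell$ added to orders mean $\ell\cdot\mathrm{ord}\,\pi_K$. For $n>0$, $P_n$ is the set of nonzero $n$-th powers. For $m>0$, $\mathrm{ac}_m:K^\times\to(\mathcal{O}_K/\pi_K^m)^\times$ is the unique group homomorphism with $\mathrm{ac}_m(\pi_K)=1$ and $\mathrm{ac}_m(u)\equiv u\bmod \pi_K^m$ for units $u$. Put $Q_{n,m}=\{x\in P_n\cdot(1+\mathcal{M}_K^m):\mathrm{ac}_m(x)=1\}$ and $\lambda Q_{n,m}=\{\lambda t:t\in Q_{n,m}\}$ for $\lambda\in K$ (so $0\cdot Q_{n,m}=\{0\}$). Relations: $R_{n,m}(x,y,z)\Leftrightarrow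 y-x\in zQ_{n,m}$; $D^{(2)}(x,y)\Leftrightarrow \mathrm{ord}\,x<\mathrm{ord}\,y$; $D^{(4)}(x,y,z,t)\Leftrightarrow\mathrm{ord}(x-y)<\mathrm{ord}(z-t)$. $\mathcal{L}_{\mathrm{dist}}=(D^{(4)},\{R_{n,m}\}_{n,m>0})$. Definable means definable with parameters from $K$. A function $f:K^k\to K$ is order-definable in $\mathcal{L}$ if $\{(x,t):\mathrm{ord}\,f(x)<\mathrm{ord}\,t\}$ is $\mathcal{L}$-definable. Cells: let $\mathcal{L}$ expand $(D^{(2)},\{R_{n,m}\})$ and $\Delta=\bigcup_k\Delta_k$, $\Delta_k$ a set of functions $K^k\to K$. An $(\mathcal{L},\Delta)$-precell in $K^k$ is a set $\{x\in K^k:\phi(x)\}$ with $\phi$ a Boolean combination of conditions $\mathrm{ord}\,a_1(x)<\mathrm{ord}\,a_2(x)+\ell$ ($a_i\in\Delta_k$, $\ell\in\mathbb{Z}$) and $b_1(x)-b_2(x)\in\lambda Q_{n,m}$ ($b_i$ quantifier-free $\mathcal{L}$-definable functions, $\lambda\in K$). An $(\mathcal{L},\Delta)$-cell in $K^{k+1}$ is a set $\{(x,t)\in D\times K:\mathrm{ord}\,a_1(x)\ \square_1\ \mathrm{ord}(t-c(x))\ \square_2\ \mathrm{ord}\,a_2(x),\ t-c(x)\in\lambda Q_{n,m}\}$ with $D$ an $(\mathcal{L},\Delta)$-precell in $K^k$, $\lambda\in K$, $n,m>0$, $a_1,a_2\in\Delta_k$, each $\square_i$ either $<$ or "no condition",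 and center $c:K^k\to K$ quantifier-free $\mathcal{L}$-definable. *)

theory Defs
  imports Main
begin

text \<open>Terms and formulas over function symbols of type 'f and relation symbols of
type 'r.  Equality is built in.  Symbols are interpreted on lists of arguments
(arity is implicit in the length of the argument list).\<close>

datatype 'f trm = Var nat | Fn 'f "'f trm list"

datatype ('f, 'r) fm =
    Rel 'r "'f trm list"
  | Eq "'f trm" "'f trm"
  | FFalse
  | Neg "('f, 'r) fm"
  | Conj "('f, 'r) fm" "('f, 'r) fm"
  | Ex nat "('f, 'r) fm"

primrec evt :: "('f \<Rightarrow> 'a list \<Rightarrow> 'a) \<Rightarrow> (nat \<Rightarrow> 'a) \<Rightarrow> 'f trm \<Rightarrow> 'a" where
  "evt F e (Var i) = e i"
| "evt F e (Fn f ts) = F f (map (evt F e) ts)"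

primrec holds :: "('f \<Rightarrow> 'a list \<Rightarrow> 'a) \<Rightarrow> ('r \<Rightarrow> 'a list \<Rightarrow> bool) \<Rightarrow> (nat \<Rightarrow> 'a)
    \<Rightarrow> ('f, 'r) fm \<Rightarrow> bool" where
  "holds F R e (Rel r ts) = R r (map (evt F e) ts)"
| "holds F R e (Eq s t) = (evt F e s = evt F e t)"
| "holds F R e FFalse = False"
| "holds F R e (Neg p) = (\<not> holds F R e p)"
| "holds F R e (Conj p q) = (holds F R e p \<and> holds F R e q)"
| "holds F R e (Ex i p) = (\<exists>a. holds F R (e(i := a)) p)"

primrec fvt :: "'f trm \<Rightarrow> nat set" where
  "fvt (Var i) = {i}"
| "fvt (Fn f ts) = \<Union> (set (map fvt ts))"

primrec fv :: "('f, 'r) fm \<Rightarrow> nat set" where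
  "fv (Rel r ts) = \<Union> (set (map fvt ts))"
| "fv (Eq s t) = fvt s \<union> fvt t"
| "fv FFalse = {}"
| "fv (Neg p) = fv p"
| "fv (Conj p q) = fv p \<union> fv q"
| "fv (Ex i p) = fv p - {i}"

primrec qfree :: "('f, 'r) fm \<Rightarrow> bool" where
  "qfree (Rel r ts) = True"
| "qfree (Eq s t) = True"
| "qfree FFalse = True"
| "qfree (Neg p) = qfree p"
| "qfree (Conj p q) = (qfree p \<and> qfree q)"
| "qfree (Ex i p) = False"

text \<open>Environment: the tuple xs occupies variables 0..length xs - 1; all other
variables are parameters (values from e).\<close>
definition envof :: "'a list \<Rightarrow> (nat \<Rightarrow> 'a) \<Rightarrow> nat \<Rightarrow> 'a" where
  "envof xs e = (\<lambda>i. if i < length xs then xs ! i else e i)"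

definition definable ::
  "('f \<Rightarrow> 'a list \<Rightarrow> 'a) \<Rightarrow> ('r \<Rightarrow> 'a list \<Rightarrow> bool) \<Rightarrow> nat \<Rightarrow> 'a list set \<Rightarrow> bool" where
  "definable F R n S \<longleftrightarrow> S \<subseteq> {xs. length xs = n} \<and>
     (\<exists>(\<phi> :: ('f, 'r) fm) e. \<forall>xs. length xs = n \<longrightarrow> (xs \<in> S \<longleftrightarrow> holds F R (envof xs e) \<phi>))"

definition qf_def_fun ::
  "('f \<Rightarrow> 'a list \<Rightarrow> 'a) \<Rightarrow> ('r \<Rightarrow> 'a list \<Rightarrow> bool) \<Rightarrow> nat \<Rightarrow> ('a list \<Rightarrow> 'a) \<Rightarrow> bool" where
  "qf_def_fun F R k c \<longleftrightarrow>
     (\<exists>(\<phi> :: ('f, 'r) fm) e. qfree \<phi> \<and>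
        (\<forall>xs t. length xs = k \<longrightarrow> (holds F R (envof (xs @ [t]) e) \<phi> \<longleftrightarrow> t = c xs)))"

datatype ogf = OPlus | OZero | ONeg
datatype ogr = OLess

definition og_funs :: "ogf \<Rightarrow> 'g::linordered_ab_group_add list \<Rightarrow> 'g" where
  "og_funs f xs = (case f of OPlus \<Rightarrow> sum_list xs | OZero \<Rightarrow> 0 | ONeg \<Rightarrow> - sum_list xs)"

definition og_rels :: "ogr \<Rightarrow> 'g::linordered_ab_group_add list \<Rightarrow> bool" where
  "og_rels r xs = (case xs of [a, b] \<Rightarrow> a < b | _ \<Rightarrow> False)"

definition elem_equiv_Z :: "'g::linordered_ab_group_add itself \<Rightarrow> bool" where
  "elem_equiv_Z _ \<longleftrightarrow>
     (\<forall>\<phi> :: (ogf, ogr) fm. fv \<phi> = {} \<longrightarrow>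
        (holds og_funs og_rels (\<lambda>_. 0 :: int) \<phi> \<longleftrightarrow> holds og_funs og_rels (\<lambda>_. 0 :: 'g) \<phi>))"

definition gmul :: "int \<Rightarrow> 'g::ab_group_add \<Rightarrow> 'g" where
  "gmul l g = (if 0 \<le> l then ((+) g ^^ nat l) 0 else - (((+) g ^^ nat (- l)) 0))"

text \<open>v is the valuation on nonzero elements (ord x = v x for x \<noteq> 0, ord 0 = \<infinity>);
the value group is the whole type 'g.\<close>
definition valuation :: "('k::field \<Rightarrow> 'g::linordered_ab_group_add) \<Rightarrow> bool" where
  "valuation v \<longleftrightarrow>
     (\<forall>x y. x \<noteq> 0 \<longrightarrow> y \<noteq> 0 \<longrightarrow> v (x * y) = v x + v y) \<and>
     (\<forall>x y. x \<noteq> 0 \<longrightarrow> y \<noteq> 0 \<longrightarrow> x + y \<noteq> 0 \<longrightarrow> min (v x) (v y) \<le> v (x + y)) \<and>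
     (\<forall>g. \<exists>x. x \<noteq> 0 \<and> v x = g)"

text \<open>ord a < ord b, with ord 0 = +\<infinity>.\<close>
definition ordlt :: "('k::field \<Rightarrow> 'g::linordered_ab_group_add) \<Rightarrow> 'k \<Rightarrow> 'k \<Rightarrow> bool" where
  "ordlt v a b \<longleftrightarrow> a \<noteq> 0 \<and> (b = 0 \<or> v a < v b)"

definition ordlt_shift ::
  "('k::field \<Rightarrow> 'g::linordered_ab_group_add) \<Rightarrow> 'k \<Rightarrow> 'k \<Rightarrow> 'k \<Rightarrow> int \<Rightarrow> bool" where
  "ordlt_shift v \<pi> a b l \<longleftrightarrow> a \<noteq> 0 \<and> (b = 0 \<or> v a < v b + gmul l (v \<pi>))"

definition valring :: "('k::field \<Rightarrow> 'g::linordered_ab_group_add) \<Rightarrow> 'k set" where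
  "valring v = {x. x = 0 \<or> 0 \<le> v x}"

definition maxideal :: "('k::field \<Rightarrow> 'g::linordered_ab_group_add) \<Rightarrow> 'k set" where
  "maxideal v = {x. x = 0 \<or> 0 < v x}"

definition residue_field :: "('k::field \<Rightarrow> 'g::linordered_ab_group_add) \<Rightarrow> 'k set set" where
  "residue_field v = valring v // {(a, b). a \<in> valring v \<and> b \<in> valring v \<and> a - b \<in> maxideal v}"

definition uniformizer :: "('k::field \<Rightarrow> 'g::linordered_ab_group_add) \<Rightarrow> 'k \<Rightarrow> bool" where
  "uniformizer v \<pi> \<longleftrightarrow> \<pi> \<noteq> 0 \<and> 0 < v \<pi> \<and> (\<forall>x. x \<noteq> 0 \<longrightarrow> 0 < v x \<longrightarrow> v \<pi> \<le> v x)"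

text \<open>(F_q, Z)-field: valued field with residue field of q elements (hence
isomorphic to F_q) and value group elementarily equivalent to Z.\<close>
definition FqZ_field :: "nat \<Rightarrow> ('k::field \<Rightarrow> 'g::linordered_ab_group_add) \<Rightarrow> bool" where
  "FqZ_field q v \<longleftrightarrow> valuation v \<and> finite (residue_field v) \<and> card (residue_field v) = q
     \<and> elem_equiv_Z TYPE('g)"

definition Mpow :: "('k::field \<Rightarrow> 'g::linordered_ab_group_add) \<Rightarrow> 'k \<Rightarrow> nat \<Rightarrow> 'k set" where
  "Mpow v \<pi> m = {x. x = 0 \<or> gmul (int m) (v \<pi>) \<le> v x}"

definition units :: "('k::field \<Rightarrow> 'g::linordered_ab_group_add) \<Rightarrow> 'k set" where
  "units v = {u. u \<noteq> 0 \<and> v u = 0}"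

definition resclass :: "('k::field \<Rightarrow> 'g::linordered_ab_group_add) \<Rightarrow> 'k \<Rightarrow> nat \<Rightarrow> 'k \<Rightarrow> 'k set" where
  "resclass v \<pi> m a = {y \<in> valring v. y - a \<in> Mpow v \<pi> m}"

text \<open>f represents a group homomorphism K^\<times> \<rightarrow> (O/\<pi>^m)^\<times> with f \<pi> = 1 and
f u = u mod \<pi>^m for units u (convention: f 0 = {}).\<close>
definition is_ac :: "('k::field \<Rightarrow> 'g::linordered_ab_group_add) \<Rightarrow> 'k \<Rightarrow> nat \<Rightarrow> ('k \<Rightarrow> 'k set) \<Rightarrow> bool" where
  "is_ac v \<pi> m f \<longleftrightarrow>
     f 0 = {} \<and>
     (\<forall>x. x \<noteq> 0 \<longrightarrow> (\<exists>u \<in> units v. f x = resclass v \<pi> m u)) \<and>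
     (\<forall>x y u w. x \<noteq> 0 \<longrightarrow> y \<noteq> 0 \<longrightarrow> u \<in> units v \<longrightarrow> w \<in> units v \<longrightarrow>
        f x = resclass v \<pi> m u \<longrightarrow> f y = resclass v \<pi> m w \<longrightarrow> f (x * y) = resclass v \<pi> m (u * w)) \<and>
     f \<pi> = resclass v \<pi> m 1 \<and>
     (\<forall>u \<in> units v. f u = resclass v \<pi> m u)"

definition ac :: "('k::field \<Rightarrow> 'g::linordered_ab_group_add) \<Rightarrow> 'k \<Rightarrow> nat \<Rightarrow> 'k \<Rightarrow> 'k set" where
  "ac v \<pi> m = (THE f. is_ac v \<pi> m f)"

definition Pn :: "nat \<Rightarrow> 'k::field set" where
  "Pn n = {y ^ n | y. y \<noteq> 0}"

definition Qnm :: "('k::field \<Rightarrow> 'g::linordered_ab_group_add) \<Rightarrow> 'k \<Rightarrow> nat \<Rightarrow> nat \<Rightarrow> 'k set" where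
  "Qnm v \<pi> n m = {x. (\<exists>p z. p \<in> Pn n \<and> z \<in> Mpow v \<pi> m \<and> x = p * (1 + z))
                    \<and> ac v \<pi> m x = resclass v \<pi> m 1}"

definition scaleQ :: "('k::field \<Rightarrow> 'g::linordered_ab_group_add) \<Rightarrow> 'k \<Rightarrow> 'k \<Rightarrow> nat \<Rightarrow> nat \<Rightarrow> 'k set" where
  "scaleQ v \<pi> lam n m = (\<lambda>t. lam * t) ` Qnm v \<pi> n m"

definition expands_Ldist ::
  "('k::field \<Rightarrow> 'g::linordered_ab_group_add) \<Rightarrow> 'k \<Rightarrow> ('f \<Rightarrow> 'k list \<Rightarrow> 'k) \<Rightarrow> ('r \<Rightarrow> 'k list \<Rightarrow> bool) \<Rightarrow> bool" where
  "expands_Ldist v \<pi> F R \<longleftrightarrow>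
     (\<exists>d. \<forall>x y z t. R d [x, y, z, t] \<longleftrightarrow> ordlt v (x - y) (z - t)) \<and>
     (\<forall>n m. 0 < n \<longrightarrow> 0 < m \<longrightarrow>
        (\<exists>r. \<forall>x y z. R r [x, y, z] \<longleftrightarrow> y - x \<in> scaleQ v \<pi> z n m))"

definition order_definable ::
  "('k::field \<Rightarrow> 'g::linordered_ab_group_add) \<Rightarrow> ('f \<Rightarrow> 'k list \<Rightarrow> 'k) \<Rightarrow> ('r \<Rightarrow> 'k list \<Rightarrow> bool)
     \<Rightarrow> nat \<Rightarrow> ('k list \<Rightarrow> 'k) \<Rightarrow> bool" where
  "order_definable v F R k f \<longleftrightarrow>
     definable F R (Suc k) {xs @ [t] | xs t. length xs = k \<and> ordlt v (f xs) t}"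

definition order_definable_coll ::
  "('k::field \<Rightarrow> 'g::linordered_ab_group_add) \<Rightarrow> ('f \<Rightarrow> 'k list \<Rightarrow> 'k) \<Rightarrow> ('r \<Rightarrow> 'k list \<Rightarrow> bool)
     \<Rightarrow> (nat \<Rightarrow> ('k list \<Rightarrow> 'k) set) \<Rightarrow> bool" where
  "order_definable_coll v F R \<Delta> \<longleftrightarrow> (\<forall>k. \<forall>f \<in> \<Delta> k. order_definable v F R k f)"

datatype 'a bcomb = BAtom 'a | BNot "'a bcomb" | BAnd "'a bcomb" "'a bcomb" | BOr "'a bcomb" "'a bcomb"

primrec beval :: "('a \<Rightarrow> bool) \<Rightarrow> 'a bcomb \<Rightarrow> bool" where
  "beval I (BAtom a) = I a"
| "beval I (BNot p) = (\<not> beval I p)"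
| "beval I (BAnd p q) = (beval I p \<and> beval I q)"
| "beval I (BOr p q) = (beval I p \<or> beval I q)"

datatype 'k patom =
    POrd "'k list \<Rightarrow> 'k" "'k list \<Rightarrow> 'k" int
  | PQ "'k list \<Rightarrow> 'k" "'k list \<Rightarrow> 'k" 'k nat nat

primrec patom_holds :: "('k::field \<Rightarrow> 'g::linordered_ab_group_add) \<Rightarrow> 'k \<Rightarrow> 'k list \<Rightarrow> 'k patom \<Rightarrow> bool" where
  "patom_holds v \<pi> x (POrd a1 a2 l) = ordlt_shift v \<pi> (a1 x) (a2 x) l"
| "patom_holds v \<pi> x (PQ b1 b2 lam n m) = (b1 x - b2 x \<in> scaleQ v \<pi> lam n m)"

primrec patom_ok ::
  "('f \<Rightarrow> 'k list \<Rightarrow> 'k) \<Rightarrow> ('r \<Rightarrow> 'k list \<Rightarrow> bool) \<Rightarrow> (nat \<Rightarrow> ('k list \<Rightarrow> 'k) set) \<Rightarrow> nat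
     \<Rightarrow> 'k patom \<Rightarrow> bool" where
  "patom_ok F R \<Delta> k (POrd a1 a2 l) = (a1 \<in> \<Delta> k \<and> a2 \<in> \<Delta> k)"
| "patom_ok F R \<Delta> k (PQ b1 b2 lam n m) = (qf_def_fun F R k b1 \<and> qf_def_fun F R k b2 \<and> 0 < n \<and> 0 < m)"

definition precell_set :: "('k::field \<Rightarrow> 'g::linordered_ab_group_add) \<Rightarrow> 'k \<Rightarrow> nat \<Rightarrow> 'k patom bcomb \<Rightarrow> 'k list set" where
  "precell_set v \<pi> k \<phi> = {x. length x = k \<and> beval (patom_holds v \<pi> x) \<phi>}"

text \<open>Cell data: precell formula D, \<lambda>, n, m, a1, a2, whether box1 is "<",
whether box2 is "<", center c.\<close>
datatype 'k celld = Cell "'k patom bcomb" 'k nat nat "'k list \<Rightarrow> 'k" "'k list \<Rightarrow> 'k" bool bool "'k list \<Rightarrow> 'k"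

primrec center :: "'k celld \<Rightarrow> 'k list \<Rightarrow> 'k" where
  "center (Cell D lam n m a1 a2 s1 s2 c) = c"

primrec cell_ok ::
  "('f \<Rightarrow> 'k list \<Rightarrow> 'k) \<Rightarrow> ('r \<Rightarrow> 'k list \<Rightarrow> bool) \<Rightarrow> (nat \<Rightarrow> ('k list \<Rightarrow> 'k) set) \<Rightarrow> nat
     \<Rightarrow> 'k celld \<Rightarrow> bool" where
  "cell_ok F R \<Delta> k (Cell D lam n m a1 a2 s1 s2 c) =
     ((\<forall>at \<in> set_bcomb D. patom_ok F R \<Delta> k at) \<and> 0 < n \<and> 0 < m \<and>
      a1 \<in> \<Delta> k \<and> a2 \<in> \<Delta> k \<and> qf_def_fun F R k c)"

primrec cell_set :: "('k::field \<Rightarrow> 'g::linordered_ab_group_add) \<Rightarrow> 'k \<Rightarrow> nat \<Rightarrow> 'k celld \<Rightarrow> 'k list set" where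
  "cell_set v \<pi> k (Cell D lam n m a1 a2 s1 s2 c) =
     {x @ [t] | x t. x \<in> precell_set v \<pi> k D \<and>
        (s1 \<longrightarrow> ordlt v (a1 x) (t - c x)) \<and> (s2 \<longrightarrow> ordlt v (t - c x) (a2 x)) \<and>
        t - c x \<in> scaleQ v \<pi> lam n m}"

end

theory Submission
  imports Defs
begin

text \<open>Every definable set \<open>D\<close> of tuples is a precell over the order-definable functions, since its
indicator function \<open>f\<close> is order-definable and \<open>x \<in> D\<close> iff \<open>ord f(x) < ord 0\<close>. So only the
variable \<open>t\<close> matters.

If neither \<open>\<lambda>\<^sub>1\<close> nor \<open>\<lambda>\<^sub>2\<close> is zero, put \<open>d = c\<^sub>1 - c\<^sub>2\<close> and choose a large constant \<open>L\<close>. Where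
\<open>ord (t - c\<^sub>1) > ord d + L\<close>, the quotient of \<open>t - c\<^sub>2\<close> by \<open>d\<close> is close to 1, so the second cell
imposes a condition on \<open>x\<close> only; symmetrically near \<open>c\<^sub>2\<close>. Where \<open>ord (t - c\<^sub>1) < ord d - L\<close>,
the quotient of \<open>t - c\<^sub>2\<close> by \<open>t - c\<^sub>1\<close> is close to 1 and both cells are conditions on \<open>t - c\<^sub>1\<close>; the
intersection of two cosets is a finite disjoint union of cosets of some \<open>Q\<^bsub>N,M\<^esub>\<close>, which has finite
index. In the remaining region \<open>ord (t - c\<^sub>1) - ord d\<close> takes finitely many values. Once this value
and the coset of \<open>t - c\<^sub>1\<close> modulo \<open>Q\<^bsub>N,M\<^esub>\<close> are fixed, \<open>t\<close> runs through a ball on which membership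
in both cells is constant, hence a definable condition on \<open>x\<close>.

The index of \<open>Q\<^bsub>N,M\<^esub>\<close> is finite, and \<open>ac\<^sub>m\<close> exists and is unique, because every nonzero element is
\<open>\<pi>\<^sup>r y\<^sup>E u\<close> with \<open>r < E\<close> and a unit \<open>u\<close>, where \<open>E\<close> is a multiple of the exponent of
\<open>(O\<^sub>K/\<pi>\<^sup>m)\<^sup>\<times>\<close>.\<close>

section \<open>Definable predicates and functions\<close>

primrec rename_trm :: "(nat \<Rightarrow> nat) \<Rightarrow> 'f trm \<Rightarrow> 'f trm" where
  "rename_trm s (Var i) = Var (s i)"
| "rename_trm s (Fn f ts) = Fn f (map (rename_trm s) ts)"

primrec rename_fm :: "(nat \<Rightarrow> nat) \<Rightarrow> ('f, 'r) fm \<Rightarrow> ('f, 'r) fm" where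
  "rename_fm s (Rel r ts) = Rel r (map (rename_trm s) ts)"
| "rename_fm s (Eq t u) = Eq (rename_trm s t) (rename_trm s u)"
| "rename_fm s FFalse = FFalse"
| "rename_fm s (Neg p) = Neg (rename_fm s p)"
| "rename_fm s (Conj p q) = Conj (rename_fm s p) (rename_fm s q)"
| "rename_fm s (Ex i p) = Ex (s i) (rename_fm s p)"

lemma evt_rename_trm: "evt F e (rename_trm s t) = evt F (e \<circ> s) t"
  by (induction t) (auto cong: map_cong simp: comp_def)

text \<open>Bound variables are renamed along with the free ones, so injectivity is what rules out
  capture: an update at \<open>s i\<close> must leave every other \<open>s j\<close> alone.\<close>

lemma holds_rename_fm:
  assumes "inj s"
  shows "holds F R e (rename_fm s p) = holds F R (e \<circ> s) p"
proof (induction p arbitrary: e)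
  case (Ex i p)
  have "e(s i := a) \<circ> s = (e \<circ> s)(i := a)" for a
    using assms by (auto simp: fun_eq_iff inj_def)
  then show ?case by (simp only: rename_fm.simps holds.simps Ex.IH)
qed (auto simp: evt_rename_trm comp_def)

text \<open>Definability is attached to predicates rather than sets, so that closure properties
  apply directly under a lambda. As in \<open>definable\<close>, the values of \<open>e\<close>
  beyond the tuple serve as parameters.\<close>

definition dpred ::
  "('f \<Rightarrow> 'a list \<Rightarrow> 'a) \<Rightarrow> ('r \<Rightarrow> 'a list \<Rightarrow> bool) \<Rightarrow> nat \<Rightarrow> ('a list \<Rightarrow> bool) \<Rightarrow> bool" where
  "dpred F R n P \<longleftrightarrow>
     (\<exists>(\<phi> :: ('f, 'r) fm) e. \<forall>xs. length xs = n \<longrightarrow> (P xs \<longleftrightarrow> holds F R (envof xs e) \<phi>))"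

text \<open>The graph is definable, with the value in the last coordinate. Quantifiers are allowed,
  in contrast to \<open>qf_def_fun\<close>.\<close>

definition vdef ::
  "('f \<Rightarrow> 'a list \<Rightarrow> 'a) \<Rightarrow> ('r \<Rightarrow> 'a list \<Rightarrow> bool) \<Rightarrow> nat \<Rightarrow> ('a list \<Rightarrow> 'a) \<Rightarrow> bool" where
  "vdef F R n c \<longleftrightarrow> dpred F R (Suc n) (\<lambda>xs. last xs = c (butlast xs))"

lemma length_SucE:
  assumes "length xs = Suc n"
  obtains ys t where "xs = ys @ [t]" "length ys = n"
  using assms by (metis length_append_singleton append_butlast_last_id length_butlast
      diff_Suc_1 list.size(3) nat.simps(3))

lemma dpred_cong:
  assumes "dpred F R n P" "\<And>xs. length xs = n \<Longrightarrow> P xs = Q xs"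
  shows "dpred F R n Q"
  using assms unfolding dpred_def by auto

lemma definable_iff_dpred: "definable F R n S \<longleftrightarrow> S \<subseteq> {xs. length xs = n} \<and> dpred F R n (\<lambda>xs. xs \<in> S)"
  unfolding definable_def dpred_def by simp

lemma dpred_rename:
  assumes P: "dpred F R n P" and inj: "inj_on s {..<n}" and img: "s ` {..<n} \<subseteq> {..<N}"
  shows "dpred F R N (\<lambda>xs. P (map (\<lambda>i. xs ! s i) [0..<n]))"
proof -
  obtain \<phi> e where \<phi>: "\<And>xs. length xs = n \<Longrightarrow> P xs \<longleftrightarrow> holds F R (envof xs e) \<phi>"
    using P unfolding dpred_def by blast
  \<comment> \<open>Coordinates move along \<open>s\<close>. The parameter positions, which begin at
    \<open>n\<close>, are shifted to begin at \<open>N\<close>, so the extended map remains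
    injective.\<close>
  define \<sigma> where "\<sigma> i = (if i < n then s i else N + (i - n))" for i
  define e' where "e' i = e (n + (i - N))" for i
  have *: "s i < N" if "i < n" for i using img that by auto
  have "inj \<sigma>"
  proof (rule injI)
    fix i j assume "\<sigma> i = \<sigma> j"
    then show "i = j" using inj *[of i] *[of j]
      by (auto simp: \<sigma>_def inj_on_def split: if_splits)
  qed
  have "envof xs e' \<circ> \<sigma> = envof (map (\<lambda>i. xs ! s i) [0..<n]) e" if "length xs = N" for xs
    using that * by (auto simp: envof_def \<sigma>_def e'_def fun_eq_iff)
  then have "P (map (\<lambda>i. xs ! s i) [0..<n]) \<longleftrightarrow> holds F R (envof xs e') (rename_fm \<sigma> \<phi>)"
    if "length xs = N" for xs
    using that by (simp add: \<phi> holds_rename_fm[OF \<open>inj \<sigma>\<close>])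
  then show ?thesis unfolding dpred_def by blast
qed

lemma dpred_take:
  assumes "dpred F R n P" "n \<le> N"
  shows "dpred F R N (\<lambda>xs. P (take n xs))"
proof (rule dpred_cong[OF dpred_rename[OF assms(1), of id]])
  show "P (map (\<lambda>i. xs ! id i) [0..<n]) = P (take n xs)" if "length xs = N" for xs
    using that assms(2) by (intro arg_cong[where f = P] nth_equalityI) auto
qed (use assms in auto)

lemma dpred_take_last:
  assumes "dpred F R (Suc n) P" "n \<le> N"
  shows "dpred F R (Suc N) (\<lambda>xs. P (take n xs @ [last xs]))"
proof (rule dpred_cong[OF dpred_rename[OF assms(1), of "\<lambda>i. if i < n then i else N"]])
  show "P (map (\<lambda>i. xs ! (if i < n then i else N)) [0..<Suc n]) = P (take n xs @ [last xs])"
    if "length xs = Suc N" for xs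
    using that assms(2)
    by (intro arg_cong[where f = P] nth_equalityI) (auto elim!: length_SucE simp: nth_append)
qed (use assms in \<open>auto simp: inj_on_def split: if_splits\<close>)

section \<open>Closure under Boolean operations, quantification and substitution\<close>

lemma dpred_False: "dpred F R n (\<lambda>_. False)"
  unfolding dpred_def by (intro exI[of _ FFalse]) simp

lemma dpred_not:
  assumes "dpred F R n P"
  shows "dpred F R n (\<lambda>xs. \<not> P xs)"
proof -
  obtain \<phi> e where "\<And>xs. length xs = n \<Longrightarrow> P xs \<longleftrightarrow> holds F R (envof xs e) \<phi>"
    using assms unfolding dpred_def by blast
  then show ?thesis unfolding dpred_def by (intro exI[of _ "Neg \<phi>"] exI[of _ e]) simp
qed

text \<open>The parameters of the two formulas are moved to the even and to the odd positions
beyond the tuple.\<close>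
lemma dpred_conj:
  assumes "dpred F R n P" "dpred F R n Q"
  shows "dpred F R n (\<lambda>xs. P xs \<and> Q xs)"
proof -
  obtain \<phi> d where \<phi>: "\<And>xs. length xs = n \<Longrightarrow> P xs \<longleftrightarrow> holds F R (envof xs d) \<phi>"
    using assms(1) unfolding dpred_def by blast
  obtain \<psi> e where \<psi>: "\<And>xs. length xs = n \<Longrightarrow> Q xs \<longleftrightarrow> holds F R (envof xs e) \<psi>"
    using assms(2) unfolding dpred_def by blast
  define \<sigma> where "\<sigma> i = (if i < n then i else n + 2 * (i - n))" for i
  define \<tau> where "\<tau> i = (if i < n then i else n + 2 * (i - n) + 1)" for i
  define g where "g i = (if even (i - n) then d else e) (n + (i - n) div 2)" for i
  have inj: "inj \<sigma>" "inj \<tau>"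
    by (auto simp: inj_def \<sigma>_def \<tau>_def split: if_splits)
  have "envof xs g \<circ> \<sigma> = envof xs d" "envof xs g \<circ> \<tau> = envof xs e" if "length xs = n" for xs
    using that by (auto simp: envof_def \<sigma>_def \<tau>_def g_def fun_eq_iff)
  then show ?thesis unfolding dpred_def
    by (intro exI[of _ "Conj (rename_fm \<sigma> \<phi>) (rename_fm \<tau> \<psi>)"] exI[of _ g])
      (simp add: \<phi> \<psi> holds_rename_fm inj)
qed

lemma dpred_disj:
  assumes "dpred F R n P" "dpred F R n Q"
  shows "dpred F R n (\<lambda>xs. P xs \<or> Q xs)"
  using dpred_not[OF dpred_conj[OF dpred_not[OF assms(1)] dpred_not[OF assms(2)]]] by simp

lemma dpred_const: "dpred F R n (\<lambda>_. b)"
  using dpred_False[of F R n] dpred_not[OF dpred_False[of F R n]] by (cases b) auto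

lemma dpred_ball:
  assumes "finite A" "\<And>a. a \<in> A \<Longrightarrow> dpred F R n (P a)"
  shows "dpred F R n (\<lambda>xs. \<forall>a\<in>A. P a xs)"
  using assms
proof (induction A)
  case empty
  then show ?case using dpred_const[of F R n True] by simp
next
  case (insert a A)
  then have "dpred F R n (\<lambda>xs. P a xs \<and> (\<forall>a\<in>A. P a xs))" by (intro dpred_conj) auto
  then show ?case by simp
qed

text \<open>Position \<open>n\<close> is a parameter for tuples of length \<open>n\<close> and the
  last coordinate for tuples of length \<open>Suc n\<close>, so quantifying over this variable
  quantifies over the coordinate.\<close>

lemma dpred_ex:
  assumes "dpred F R (Suc n) P"
  shows "dpred F R n (\<lambda>xs. \<exists>t. P (xs @ [t]))"
proof -
  obtain \<phi> e where \<phi>: "\<And>xs. length xs = Suc n \<Longrightarrow> P xs \<longleftrightarrow> holds F R (envof xs e) \<phi>"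
    using assms unfolding dpred_def by blast
  have "envof (xs @ [t]) e = (envof xs e)(n := t)" if "length xs = n" for xs t
    using that by (auto simp: envof_def fun_eq_iff nth_append)
  then show ?thesis unfolding dpred_def
    by (intro exI[of _ "Ex n \<phi>"] exI[of _ e]) (auto simp: \<phi>)
qed

lemma dpred_subst:
  assumes "dpred F R (Suc n) P" "vdef F R n c"
  shows "dpred F R n (\<lambda>xs. P (xs @ [c xs]))"
  using dpred_ex[OF dpred_conj[OF assms(1) assms(2)[unfolded vdef_def]]] by simp

lemma vdef_take:
  assumes "vdef F R n c" "n \<le> N"
  shows "vdef F R N (\<lambda>xs. c (take n xs))"
  unfolding vdef_def
  by (rule dpred_cong[OF dpred_take_last[OF assms(1)[unfolded vdef_def] assms(2)]])
    (use assms(2) in \<open>auto elim!: length_SucE\<close>)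

lemma vdef_nth:
  assumes "i < n"
  shows "vdef F R n (\<lambda>xs. xs ! i)"
  unfolding vdef_def dpred_def using assms
  by (intro exI[of _ "Eq (Var n) (Var i)"])
    (auto elim!: length_SucE simp: envof_def nth_append)

lemma vdef_const: "vdef F R n (\<lambda>_. a)"
  unfolding vdef_def dpred_def
  by (intro exI[of _ "Eq (Var n) (Var (Suc n))"] exI[of _ "\<lambda>_. a"])
    (auto elim!: length_SucE simp: envof_def nth_append)

lemma qf_def_fun_imp_vdef:
  assumes "qf_def_fun F R k c"
  shows "vdef F R k c"
proof -
  obtain \<phi> e where "\<And>xs t. length xs = k \<Longrightarrow> holds F R (envof (xs @ [t]) e) \<phi> \<longleftrightarrow> t = c xs"
    using assms unfolding qf_def_fun_def by blast
  then show ?thesis unfolding vdef_def dpred_def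
    by (intro exI[of _ \<phi>] exI[of _ e]) (auto elim!: length_SucE)
qed

lemma dpred_rel:
  fixes fs :: "('a list \<Rightarrow> 'a) list"
  assumes "\<forall>f \<in> set fs. vdef F R n f"
  shows "dpred F R n (\<lambda>xs. R r (map (\<lambda>f. f xs) fs))"
proof -
  \<comment> \<open>The claim is generalised for induction on \<open>fs\<close>: the first
    \<open>j\<close> arguments of the relation are the extra coordinates \<open>drop n xs\<close>.
    The step from \<open>Suc j\<close> to \<open>j\<close> substitutes the value of \<open>f\<close>
    for the last coordinate.\<close>
  have "dpred F R (n + j) (\<lambda>xs. R r (drop n xs @ map (\<lambda>f. f (take n xs)) fs))" for j
    using assms
  proof (induction fs arbitrary: j)
    case Nil
    have "map (envof xs e) [n..<n + j] = drop n xs" if "length xs = n + j" for xs :: "'a list" and e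
      using that by (intro nth_equalityI) (auto simp: envof_def)
    then show ?case unfolding dpred_def
      by (intro exI[of _ "Rel r (map Var [n..<n + j])"] exI[of _ "\<lambda>_. undefined"]) (simp add: comp_def)
  next
    case (Cons f fs)
    have "dpred F R (Suc (n + j)) (\<lambda>xs. R r (drop n xs @ map (\<lambda>f. f (take n xs)) fs))"
      using Cons.IH[of "Suc j"] Cons.prems by simp
    moreover have "vdef F R (n + j) (\<lambda>xs. f (take n xs))"
      using Cons.prems by (intro vdef_take) auto
    ultimately show ?case
      by (rule dpred_cong[OF dpred_subst]) simp
  qed
  from this[of 0] have "dpred F R n (\<lambda>xs. R r (drop n xs @ map (\<lambda>f. f (take n xs)) fs))"
    by simp
  then show ?thesis by (rule dpred_cong) simp
qed

section \<open>Valued fields whose value group is a Z-group\<close>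

lemma gmul_of_nat: "gmul (int m) g = ((+) g ^^ m) 0"
  by (simp add: gmul_def)

lemma gmul_Suc: "gmul (int (Suc m)) g = g + gmul (int m) g"
  unfolding gmul_of_nat by simp

lemma gmul_zero: "gmul 0 g = 0"
  by (simp add: gmul_def)

lemma gmul_neg: "gmul (- int m) g = - gmul (int m) g"
  by (cases "m = 0") (auto simp: gmul_def)

lemma gmul_add: "gmul (int (m + n)) g = gmul (int m) g + gmul (int n) (g :: 'g::linordered_ab_group_add)"
  by (induction m) (simp_all add: gmul_Suc gmul_zero add.assoc del: of_nat_Suc of_nat_add)

lemma gmul_minus: "gmul (int m) (- g) = - gmul (int m) (g :: 'g::linordered_ab_group_add)"
  by (induction m) (simp_all add: gmul_Suc gmul_zero add.commute del: of_nat_Suc)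

lemma gmul_mono: "g \<le> h \<Longrightarrow> gmul (int m) g \<le> gmul (int m) (h :: 'g::linordered_ab_group_add)"
  by (induction m) (simp_all add: gmul_Suc gmul_zero add_mono del: of_nat_Suc)

lemma gmul_zero_right: "gmul (int m) 0 = (0 :: 'g::linordered_ab_group_add)"
  by (induction m) (simp_all add: gmul_Suc gmul_zero del: of_nat_Suc)

lemma gmul_pos: "0 < g \<Longrightarrow> 0 < m \<Longrightarrow> 0 < gmul (int m) (g :: 'g::linordered_ab_group_add)"
  using gmul_mono[of 0 g "m - 1"]
  by (cases m) (simp_all add: gmul_Suc gmul_zero_right add_pos_nonneg del: of_nat_Suc)

lemma sum_list_replicate_gmul:
  "sum_list (replicate m g) = gmul (int m) (g :: 'g::linordered_ab_group_add)"
  by (induction m) (simp_all add: gmul_Suc gmul_zero del: of_nat_Suc)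

text \<open>Division with remainder by \<open>E\<close> is transferred from \<open>\<int>\<close>. In the sentence the
remainder is bounded by \<open>E\<close> times the least positive element.\<close>
lemma elem_equiv_Z_division:
  fixes p :: "'g::linordered_ab_group_add"
  assumes "elem_equiv_Z TYPE('g)" "0 < p" "\<And>g. 0 < g \<Longrightarrow> p \<le> g" "0 < E"
  shows "\<exists>h :: 'g. gmul (int E) h \<le> g \<and> g < gmul (int E) h + gmul (int E) p"
proof -
  define Z :: "ogf trm" where "Z = Fn OZero []"
  \<comment> \<open>The language has no constant for 1, so \<open>L\<close> describes variable 0 as
    the least positive element. \<open>S\<close> says that each value of variable 1 is at least
    \<open>E\<close> times some variable 2 and below that multiple plus \<open>E\<close> times
    variable 0.\<close>
  define L :: "(ogf, ogr) fm" where "L = Conj (Rel OLess [Z, Var 0])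
    (Neg (Ex 1 (Conj (Rel OLess [Z, Var 1]) (Rel OLess [Var 1, Var 0]))))"
  define S :: "(ogf, ogr) fm" where "S = Neg (Ex 1 (Neg (Ex 2 (Conj
    (Neg (Rel OLess [Var 1, Fn OPlus (replicate E (Var 2))]))
    (Rel OLess [Var 1, Fn OPlus (replicate E (Var 2) @ replicate E (Var 0))])))))"
  define \<phi> where "\<phi> = Ex 0 (Conj L S)"
  have "fv \<phi> = {}" by (auto simp: \<phi>_def L_def S_def Z_def)
  moreover have "holds og_funs og_rels (\<lambda>_. 0 :: int) \<phi>"
  proof -
    have 1: "holds og_funs og_rels ((\<lambda>_. 0 :: int)(0 := 1)) L"
      by (auto simp: L_def Z_def og_rels_def og_funs_def)
    have "int E * (a div int E) \<le> a" "a < int E * (a div int E) + int E" for a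
      using \<open>0 < E\<close> mult_div_mod_eq[of "int E" a] pos_mod_bound[of "int E" a]
        pos_mod_sign[of "int E" a] by linarith+
    then have "\<exists>y. int E * y \<le> a \<and> a < int E * y + int E" for a by blast
    then have 2: "holds og_funs og_rels ((\<lambda>_. 0 :: int)(0 := 1)) S"
      by (simp add: S_def og_rels_def og_funs_def sum_list_replicate not_less)
    show ?thesis unfolding \<phi>_def using 1 2 by auto
  qed
  ultimately have "holds og_funs og_rels (\<lambda>_. 0 :: 'g) \<phi>"
    using assms(1) unfolding elem_equiv_Z_def by blast
  then obtain u :: 'g where u: "holds og_funs og_rels ((\<lambda>_. 0)(0 := u)) L"
    "holds og_funs og_rels ((\<lambda>_. 0)(0 := u)) S"
    unfolding \<phi>_def by auto
  have "0 < u" "\<And>z. 0 < z \<Longrightarrow> u \<le> z"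
    using u(1) by (auto simp: L_def Z_def og_rels_def og_funs_def not_less) (metis leD)
  then have "u = p" using assms(2,3) by (meson order_antisym)
  have "\<forall>a. \<exists>h. gmul (int E) h \<le> a \<and> \<not> gmul (int E) h + gmul (int E) p \<le> a"
    using u(2) unfolding \<open>u = p\<close>
    by (simp add: S_def og_rels_def og_funs_def sum_list_replicate_gmul not_less)
  then show ?thesis by (meson not_le)
qed

locale FqZ =
  fixes q :: nat
    and v :: "'k::field \<Rightarrow> 'g::linordered_ab_group_add"
    and \<pi> :: 'k
  assumes FqZ: "FqZ_field q v"
    and unif: "uniformizer v \<pi>"
begin

section \<open>The valuation and the comparison of orders\<close>

lemma val: "valuation v"
  using FqZ by (simp add: FqZ_field_def)

lemma v_mult: "x \<noteq> 0 \<Longrightarrow> y \<noteq> 0 \<Longrightarrow> v (x * y) = v x + v y"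
  using val unfolding valuation_def by blast

lemma v_add: "x \<noteq> 0 \<Longrightarrow> y \<noteq> 0 \<Longrightarrow> x + y \<noteq> 0 \<Longrightarrow> min (v x) (v y) \<le> v (x + y)"
  using val unfolding valuation_def by blast

lemma v_surj: obtains x where "x \<noteq> 0" "v x = g"
  using val unfolding valuation_def by blast

lemma v_one [simp]: "v 1 = 0"
  using v_mult[of 1 1] by simp

lemma v_minus [simp]: "v (- x) = v x"
proof (cases "x = 0")
  case False
  have "v (-1) = 0" using v_mult[of "-1" "-1"] by simp
  then show ?thesis using False v_mult[of "-1" x] by simp
qed simp

lemma v_inverse: "x \<noteq> 0 \<Longrightarrow> v (inverse x) = - v x"
  using v_mult[of x "inverse x"] by (simp add: eq_neg_iff_add_eq_0 add.commute)

lemma v_divide: "x \<noteq> 0 \<Longrightarrow> y \<noteq> 0 \<Longrightarrow> v (x / y) = v x - v y"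
  by (simp add: divide_inverse v_mult v_inverse)

lemma v_power: "x \<noteq> 0 \<Longrightarrow> v (x ^ m) = gmul (int m) (v x)"
  by (induction m) (simp_all add: v_mult gmul_Suc gmul_zero del: of_nat_Suc)

lemma pi_nz [simp]: "\<pi> \<noteq> 0" and v_pi_pos: "0 < v \<pi>"
  and v_pi_least: "x \<noteq> 0 \<Longrightarrow> 0 < v x \<Longrightarrow> v \<pi> \<le> v x"
  using unif unfolding uniformizer_def by auto

lemma discrete: "g < h \<Longrightarrow> g + v \<pi> \<le> h"
  by (metis add.commute diff_gt_0_iff_gt le_diff_eq v_pi_least v_surj)

abbreviation olt :: "'k \<Rightarrow> 'k \<Rightarrow> bool" where "olt \<equiv> ordlt v"

lemma olt_neqs: "olt a b \<Longrightarrow> a \<noteq> 0" "\<not> olt 0 b" "olt a 0 \<longleftrightarrow> a \<noteq> 0" "\<not> olt a a"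
  by (auto simp: ordlt_def)

lemma olt_trans: "olt a b \<Longrightarrow> olt b c \<Longrightarrow> olt a c"
  by (auto simp: ordlt_def)

lemma olt_le_trans: "olt a b \<Longrightarrow> \<not> olt c b \<Longrightarrow> olt a c"
  by (auto simp: ordlt_def)

lemma le_olt_trans: "\<not> olt b a \<Longrightarrow> olt b c \<Longrightarrow> olt a c"
  by (auto simp: ordlt_def)

lemma le_trans: "\<not> olt b a \<Longrightarrow> \<not> olt c b \<Longrightarrow> \<not> olt c a"
  by (auto simp: ordlt_def)

text \<open>Order-definability only gives access to comparisons of ord f with ord s for a variable
  s. The comparison of two such functions is therefore expressed through a witness;
  \<open>s = b\<close> serves.\<close>

lemma olt_interpolate: "(\<exists>s. olt a s \<and> \<not> olt b s) \<longleftrightarrow> olt a b"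
  using olt_neqs olt_le_trans by blast

lemma olt_mult_cancel: "c \<noteq> 0 \<Longrightarrow> olt (c * a) (c * b) \<longleftrightarrow> olt a b"
  by (cases "a = 0"; cases "b = 0") (auto simp: ordlt_def v_mult)

lemma olt_cong: "a \<noteq> 0 \<Longrightarrow> a' \<noteq> 0 \<Longrightarrow> v a = v a' \<Longrightarrow> olt a b \<longleftrightarrow> olt a' b"
    "a \<noteq> 0 \<Longrightarrow> a' \<noteq> 0 \<Longrightarrow> v a = v a' \<Longrightarrow> olt b a \<longleftrightarrow> olt b a'"
  by (auto simp: ordlt_def)

lemma olt_minus [simp]: "olt (- a) b \<longleftrightarrow> olt a b" "olt a (- b) \<longleftrightarrow> olt a b"
  by (auto simp: ordlt_def)

lemma olt_add: "\<not> olt a c \<Longrightarrow> \<not> olt b c \<Longrightarrow> \<not> olt (a + b) c"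
  using v_add[of a b] by (cases "a = 0"; cases "b = 0") (auto simp: ordlt_def min_def split: if_splits)

lemma pi_olt: "a \<noteq> 0 \<Longrightarrow> olt a (\<pi> * a)"
  using v_pi_pos by (auto simp: ordlt_def v_mult)

text \<open>The term of smaller order dominates. The upper bound on the order of the sum comes from
  the ultrametric inequality for \<open>a = (a + b) + (- b)\<close>.\<close>

lemma olt_add_eq:
  assumes "olt a b"
  shows "a + b \<noteq> 0" "v (a + b) = v a"
proof -
  have a: "a \<noteq> 0" and ab: "b \<noteq> 0 \<Longrightarrow> v a < v b" using assms by (auto simp: ordlt_def)
  show nz: "a + b \<noteq> 0"
  proof
    assume "a + b = 0"
    then have "b = - a" by (simp add: eq_neg_iff_add_eq_0 add.commute)
    then show False using ab a by auto
  qed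
  show "v (a + b) = v a"
  proof (cases "b = 0")
    case False
    have "v a \<le> v (a + b)" "v a \<ge> v (a + b)"
      using v_add[of a b] v_add[of "a + b" "- b"] nz a ab False
      by (auto simp: min_def split: if_splits)
    then show ?thesis by simp
  qed simp
qed

text \<open>The value group is discrete: exceeding ord a means being at least ord a + 1. This
  converts strict bounds into non-strict ones and back.\<close>

lemma olt_iff_not_olt_pi:
  assumes "a \<noteq> 0"
  shows "olt a b \<longleftrightarrow> \<not> olt b (\<pi> * a)"
proof (cases "b = 0")
  case False
  have "v a < v b \<longleftrightarrow> v \<pi> + v a \<le> v b"
    using discrete[of "v a" "v b"] v_pi_pos
    by (metis add.commute less_add_same_cancel2 order_less_le_trans)
  then show ?thesis using False assms by (auto simp: ordlt_def v_mult not_less)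
qed (use assms in \<open>auto simp: olt_neqs\<close>)

text \<open>Integer shifts are absorbed into powers of \<pi>, on the right for positive shifts and
  on the left for negative ones, so that precell conditions become plain comparisons of
  orders.\<close>

lemma ordlt_shift_nonneg: "ordlt_shift v \<pi> a b (int m) \<longleftrightarrow> olt a (\<pi> ^ m * b)"
  by (cases "b = 0") (auto simp: ordlt_shift_def ordlt_def v_mult v_power add.commute)

lemma ordlt_shift_neg: "ordlt_shift v \<pi> a b (- int m) \<longleftrightarrow> olt (\<pi> ^ m * a) b"
  by (auto simp: ordlt_shift_def ordlt_def v_mult v_power gmul_neg less_diff_eq add.commute)

section \<open>The valuation ring, the powers of its maximal ideal, and the 1-units\<close>

lemma valring_iff: "x \<in> valring v \<longleftrightarrow> \<not> olt x 1"
  by (auto simp: valring_def ordlt_def)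

lemma Mpow_iff: "x \<in> Mpow v \<pi> m \<longleftrightarrow> \<not> olt x (\<pi> ^ m)"
  by (auto simp: Mpow_def ordlt_def v_power)

lemma Mpow_mult_cancel: "c \<noteq> 0 \<Longrightarrow> \<not> olt (c * x) (c * \<pi> ^ m) \<longleftrightarrow> x \<in> Mpow v \<pi> m"
  by (simp add: Mpow_iff olt_mult_cancel)

lemma Mpow_eq: "x \<in> Mpow v \<pi> m \<longleftrightarrow> (\<exists>y \<in> valring v. x = \<pi> ^ m * y)"
proof
  assume "x \<in> Mpow v \<pi> m"
  then have "x / \<pi> ^ m \<in> valring v"
    using olt_mult_cancel[of "\<pi> ^ m" "x / \<pi> ^ m" 1] by (simp add: Mpow_iff valring_iff)
  then show "\<exists>y \<in> valring v. x = \<pi> ^ m * y" by (intro bexI[of _ "x / \<pi> ^ m"]) auto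
next
  assume "\<exists>y \<in> valring v. x = \<pi> ^ m * y"
  then show "x \<in> Mpow v \<pi> m"
    using olt_mult_cancel[of "\<pi> ^ m" _ 1] by (auto simp: Mpow_iff valring_iff)
qed

lemma valring_one: "1 \<in> valring v" and valring_zero: "0 \<in> valring v"
  by (auto simp: valring_def)

lemma valring_add: "x \<in> valring v \<Longrightarrow> y \<in> valring v \<Longrightarrow> x + y \<in> valring v"
  unfolding valring_iff by (rule olt_add)

lemma valring_mult: "x \<in> valring v \<Longrightarrow> y \<in> valring v \<Longrightarrow> x * y \<in> valring v"
  by (cases "x = 0 \<or> y = 0") (auto simp: valring_def v_mult)

lemma valring_pi_power: "\<pi> ^ m \<in> valring v"
proof (induction m)
  case (Suc m)
  have "\<pi> \<in> valring v" using v_pi_pos by (simp add: valring_def)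
  then show ?case using Suc valring_mult by simp
qed (simp add: valring_one)

lemma Mpow_zero: "0 \<in> Mpow v \<pi> m"
  by (simp add: Mpow_def)

lemma Mpow_add: "x \<in> Mpow v \<pi> m \<Longrightarrow> y \<in> Mpow v \<pi> m \<Longrightarrow> x + y \<in> Mpow v \<pi> m"
  unfolding Mpow_iff by (rule olt_add)

lemma Mpow_minus: "- x \<in> Mpow v \<pi> m \<longleftrightarrow> x \<in> Mpow v \<pi> m"
  by (simp add: Mpow_iff)

lemma Mpow_mult: "x \<in> Mpow v \<pi> m \<Longrightarrow> y \<in> valring v \<Longrightarrow> x * y \<in> Mpow v \<pi> m"
  using valring_mult unfolding Mpow_eq by (metis mult.assoc)

lemma Mpow_mono: "m \<le> M \<Longrightarrow> x \<in> Mpow v \<pi> M \<Longrightarrow> x \<in> Mpow v \<pi> m"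
proof -
  assume "m \<le> M" "x \<in> Mpow v \<pi> M"
  then obtain y where y: "y \<in> valring v" "x = \<pi> ^ M * y" using Mpow_eq by blast
  with \<open>m \<le> M\<close> have "x = \<pi> ^ m * (\<pi> ^ (M - m) * y)"
    by (simp add: mult.assoc[symmetric] power_add[symmetric])
  then show ?thesis using y valring_mult valring_pi_power Mpow_eq by blast
qed

lemma Mpow_le_valring: "x \<in> Mpow v \<pi> m \<Longrightarrow> x \<in> valring v"
  using Mpow_mono[of 0 m x] by (simp add: Mpow_eq)

lemma Mpow_one_eq: "Mpow v \<pi> 1 = maxideal v"
  using v_pi_least v_pi_pos by (auto simp: Mpow_def maxideal_def gmul_def)

text \<open>For \<open>m > 0\<close> this is the group of \<open>1\<close>-units \<open>1 + M\<^sub>K\<^sup>m\<close>.\<close>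
definition ounits :: "nat \<Rightarrow> 'k set" where
  "ounits m = {x. x - 1 \<in> Mpow v \<pi> m}"

lemma units_iff: "u \<in> units v \<longleftrightarrow> u \<noteq> 0 \<and> v u = 0"
  by (simp add: units_def)

lemma units_nz: "u \<in> units v \<Longrightarrow> u \<noteq> 0"
  by (simp add: units_def)

lemma units_valring: "u \<in> units v \<Longrightarrow> u \<in> valring v"
  by (simp add: units_def valring_def)

lemma units_one: "1 \<in> units v"
  by (simp add: units_def)

lemma units_mult: "u \<in> units v \<Longrightarrow> w \<in> units v \<Longrightarrow> u * w \<in> units v"
  by (simp add: units_def v_mult)

lemma units_inverse: "u \<in> units v \<Longrightarrow> inverse u \<in> units v"
  by (simp add: units_def v_inverse)

lemma units_divide: "u \<in> units v \<Longrightarrow> w \<in> units v \<Longrightarrow> u / w \<in> units v"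
  by (simp add: units_def v_divide)

lemma units_power: "u \<in> units v \<Longrightarrow> u ^ n \<in> units v"
  by (induction n) (auto simp: units_one units_mult)

lemma ounits_units:
  assumes "0 < m" "x \<in> ounits m"
  shows "x \<in> units v"
proof -
  have "x - 1 \<in> maxideal v"
    using assms Mpow_mono[of 1 m "x - 1"] by (simp add: ounits_def Mpow_one_eq[symmetric])
  then have *: "olt 1 (x - 1)" by (auto simp: maxideal_def ordlt_def)
  from olt_add_eq[OF this] show ?thesis by (simp add: units_def)
qed

lemma ounits_iff_div:
  assumes "u \<in> units v" "w \<in> units v"
  shows "u / w \<in> ounits m \<longleftrightarrow> u - w \<in> Mpow v \<pi> m"
proof -
  have eq: "u / w - 1 = (u - w) * inverse w" "u - w = (u / w - 1) * w"
    using assms units_nz by (auto simp: field_simps)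
  show ?thesis unfolding ounits_def mem_Collect_eq
    using Mpow_mult[of "u - w" m "inverse w"] Mpow_mult[of "u / w - 1" m w] assms
      units_valring units_inverse eq by metis
qed

lemma ounits_one: "1 \<in> ounits m"
  by (simp add: ounits_def Mpow_zero)

lemma ounits_mult:
  assumes "x \<in> ounits m" "y \<in> ounits m"
  shows "x * y \<in> ounits m"
proof -
  have "y \<in> valring v"
    using assms valring_add[of "y - 1" 1] Mpow_le_valring valring_one by (auto simp: ounits_def)
  then have "(x - 1) * y + (y - 1) \<in> Mpow v \<pi> m"
    using assms by (intro Mpow_add Mpow_mult) (auto simp: ounits_def)
  then show ?thesis by (simp add: ounits_def algebra_simps)
qed

lemma ounits_inverse:
  assumes "0 < m" "x \<in> ounits m"
  shows "inverse x \<in> ounits m"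
  using ounits_iff_div[of 1 x m] ounits_units[OF assms] assms units_one Mpow_minus[of "x - 1" m]
  by (simp add: ounits_def inverse_eq_divide)

lemma ounits_mono: "m \<le> M \<Longrightarrow> x \<in> ounits M \<Longrightarrow> x \<in> ounits m"
  using Mpow_mono by (auto simp: ounits_def)

lemma ounits_power: "x \<in> ounits m \<Longrightarrow> x ^ n \<in> ounits m"
  by (induction n) (auto simp: ounits_one ounits_mult)

lemma resclass_eq_iff:
  assumes "a \<in> valring v" "b \<in> valring v"
  shows "resclass v \<pi> m a = resclass v \<pi> m b \<longleftrightarrow> a - b \<in> Mpow v \<pi> m"
proof
  assume *: "resclass v \<pi> m a = resclass v \<pi> m b"
  have "a \<in> resclass v \<pi> m a" using assms by (simp add: resclass_def Mpow_zero)
  then show "a - b \<in> Mpow v \<pi> m" unfolding * by (simp add: resclass_def)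
next
  assume *: "a - b \<in> Mpow v \<pi> m"
  have "- (a - b) \<in> Mpow v \<pi> m" using * Mpow_minus by blast
  then have "y - b \<in> Mpow v \<pi> m \<longleftrightarrow> y - a \<in> Mpow v \<pi> m" for y
    using Mpow_add[OF _ *, of "y - a"] Mpow_add[of "y - b" m "- (a - b)"] by auto
  then show "resclass v \<pi> m a = resclass v \<pi> m b" by (simp add: resclass_def)
qed

lemma resclass_units_eq_iff:
  assumes "u \<in> units v" "w \<in> units v"
  shows "resclass v \<pi> m u = resclass v \<pi> m w \<longleftrightarrow> u / w \<in> ounits m"
  using assms by (simp add: resclass_eq_iff units_valring ounits_iff_div)

section \<open>Decomposition of nonzero elements and finiteness of the residue rings\<close>

lemma v_between:
  assumes "x \<noteq> 0" "0 \<le> v x" "v x < v (\<pi> ^ E)"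
  shows "\<exists>r<E. v x = v (\<pi> ^ r)"
  using assms
proof (induction E)
  case (Suc E)
  show ?case
  proof (cases "v x < v (\<pi> ^ E)")
    case True
    then show ?thesis using Suc less_SucI by blast
  next
    case False
    have "v (\<pi> ^ Suc E) = v (\<pi> ^ E) + v \<pi>" by (simp add: v_mult add.commute)
    then have "v x = v (\<pi> ^ E)" using False discrete[of "v (\<pi> ^ E)" "v x"] Suc.prems by fastforce
    then show ?thesis by blast
  qed
qed simp

text \<open>Division of \<open>v x\<close> by \<open>E\<close> with remainder yields the order of
  \<open>y\<close>. The order of \<open>x / y ^ E\<close> then lies in the range from 0 to below
  \<open>E\<close> times that of \<pi>, where the only orders are those of the powers
  \<open>\<pi> ^ r\<close>.\<close>

lemma pi_power_decomp:
  assumes "0 < E" "x \<noteq> 0"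
  obtains r y u where "r < E" "y \<noteq> 0" "u \<in> units v" "x = \<pi> ^ r * y ^ E * u"
proof -
  have "elem_equiv_Z TYPE('g)" using FqZ by (simp add: FqZ_field_def)
  moreover have "0 < g \<Longrightarrow> v \<pi> \<le> g" for g by (metis v_pi_least v_surj)
  ultimately obtain h where h: "gmul (int E) h \<le> v x" "v x < gmul (int E) h + gmul (int E) (v \<pi>)"
    using elem_equiv_Z_division v_pi_pos assms(1) by blast
  obtain y where y: "y \<noteq> 0" "v y = h" using v_surj by blast
  define z where "z = x / y ^ E"
  have z: "z \<noteq> 0" "x = z * y ^ E" "v z = v x - gmul (int E) h"
    using y assms by (auto simp: z_def v_divide v_power)
  have "0 \<le> v z" using h(1) z(3) by simp
  moreover have "v z < v (\<pi> ^ E)"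
    using h(2) z(3) by (simp add: v_power diff_less_eq add.commute)
  ultimately have "\<exists>r<E. v z = v (\<pi> ^ r)" by (rule v_between[OF z(1)])
  then obtain r where r: "r < E" "v z = v (\<pi> ^ r)" by blast
  have "z / \<pi> ^ r \<in> units v" using r z by (simp add: units_def v_divide)
  moreover have "x = \<pi> ^ r * y ^ E * (z / \<pi> ^ r)" using z by simp
  ultimately show thesis using r y that by blast
qed

text \<open>Digit expansion: if \<open>s\<close> represents \<open>x\<close> modulo \<pi>^m and
  \<open>t\<close> represents the residue of (x - s)/\<pi>^m, then \<open>s + \<pi> ^ m * t\<close>
  represents \<open>x\<close> modulo \<pi>^(m+1).\<close>

lemma finite_residues:
  "\<exists>S. finite S \<and> S \<subseteq> valring v \<and> (\<forall>x \<in> valring v. \<exists>s \<in> S. x - s \<in> Mpow v \<pi> m)"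
proof (induction m)
  case 0
  then show ?case
    by (intro exI[of _ "{0}"]) (auto simp: valring_zero Mpow_eq)
next
  case (Suc m)
  define r where "r = {(a, b). a \<in> valring v \<and> b \<in> valring v \<and> a - b \<in> maxideal v}"
  have fin: "finite (valring v // r)"
    using FqZ by (simp add: FqZ_field_def residue_field_def r_def)
  define T where "T = (\<lambda>X. SOME a. a \<in> X) ` (valring v // r)"
  have T: "\<exists>t \<in> T. t \<in> valring v \<and> x - t \<in> Mpow v \<pi> 1" if "x \<in> valring v" for x
  proof (rule bexI)
    show "(SOME a. a \<in> r `` {x}) \<in> T" using that by (unfold T_def quotient_def) blast
    have "x \<in> r `` {x}" using that by (simp add: r_def maxideal_def)
    then have "(SOME a. a \<in> r `` {x}) \<in> r `` {x}" by (rule someI)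
    then show "(SOME a. a \<in> r `` {x}) \<in> valring v \<and> x - (SOME a. a \<in> r `` {x}) \<in> Mpow v \<pi> 1"
      by (auto simp: r_def Mpow_one_eq simp del: One_nat_def)
  qed
  obtain S where S: "finite S" "S \<subseteq> valring v"
    "\<And>x. x \<in> valring v \<Longrightarrow> \<exists>s \<in> S. x - s \<in> Mpow v \<pi> m" using Suc by blast
  define U where "U = (\<lambda>(s, t). s + \<pi> ^ m * t) ` (S \<times> (T \<inter> valring v))"
  show ?case
  proof (intro exI[of _ U] conjI ballI)
    show "finite U" using S fin by (auto simp: U_def T_def)
    show "U \<subseteq> valring v"
      using S valring_add valring_mult valring_pi_power by (auto simp: U_def)
    fix x assume "x \<in> valring v"
    then obtain s y where s: "s \<in> S" "y \<in> valring v" "x - s = \<pi> ^ m * y"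
      using S(3) Mpow_eq by blast
    obtain t where t1: "t \<in> T" "t \<in> valring v" "y - t \<in> Mpow v \<pi> 1"
      using T[OF s(2)] by blast
    obtain z where "z \<in> valring v" "y - t = \<pi> ^ 1 * z"
      using t1(3) Mpow_eq by blast
    with t1 have t: "t \<in> T" "t \<in> valring v" "z \<in> valring v" "y - t = \<pi> * z" by auto
    have "x - (s + \<pi> ^ m * t) = \<pi> ^ m * (y - t)" using s(3) by (simp add: algebra_simps)
    also have "\<dots> = \<pi> ^ Suc m * z" using t by simp
    finally have "x - (s + \<pi> ^ m * t) \<in> Mpow v \<pi> (Suc m)" using t Mpow_eq by blast
    moreover have "s + \<pi> ^ m * t \<in> U" using s t by (auto simp: U_def)
    ultimately show "\<exists>s \<in> U. x - s \<in> Mpow v \<pi> (Suc m)" by blast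
  qed
qed

text \<open>For positive \<open>m\<close> these are the positive multiples of the exponent of the
  unit group of O/\<pi>^m. Raising to such a power makes any unit trivial modulo \<pi>^m, hence
  invisible to the angular component.\<close>

definition unit_exponent :: "nat \<Rightarrow> nat \<Rightarrow> bool" where
  "unit_exponent m E \<longleftrightarrow> 0 < E \<and> (\<forall>u \<in> units v. u ^ E \<in> ounits m)"

lemma unit_exponent_dvd:
  assumes "unit_exponent m E" "E dvd E'" "0 < E'"
  shows "unit_exponent m E'"
proof -
  obtain k where "E' = E * k" using assms(2) by (rule dvdE)
  then show ?thesis using assms by (simp add: unit_exponent_def power_mult ounits_power)
qed

text \<open>Pigeonhole: two of the powers of \<open>u\<close> with exponents 0 to
  \<open>card S\<close> are congruent, so \<open>u ^ (j - i)\<close> is trivial for some positive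
  difference of at most \<open>card S\<close>. The factorial is a multiple of all these differences,
  so it works for every unit at once.\<close>

lemma ex_unit_exponent: "\<exists>E. unit_exponent m E"
proof -
  obtain S where "finite S \<and> S \<subseteq> valring v \<and> (\<forall>x \<in> valring v. \<exists>s \<in> S. x - s \<in> Mpow v \<pi> m)"
    using finite_residues[of m] ..
  then have S: "finite S" "\<forall>x \<in> valring v. \<exists>s \<in> S. x - s \<in> Mpow v \<pi> m" by simp_all
  have *: "u ^ fact (card S) \<in> ounits m" if u: "u \<in> units v" for u
  proof -
    define f where "f i = (SOME s. s \<in> S \<and> u ^ i - s \<in> Mpow v \<pi> m)" for i
    have f: "f i \<in> S \<and> u ^ i - f i \<in> Mpow v \<pi> m" for i
    proof -
      have "u ^ i \<in> valring v" by (rule units_valring[OF units_power[OF u]])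
      from S(2)[rule_format, OF this] show ?thesis unfolding f_def Bex_def by (rule someI_ex)
    qed
    have "\<not> inj_on f {..card S}"
    proof
      assume inj: "inj_on f {..card S}"
      have "f ` {..card S} \<subseteq> S" using f by (rule image_subsetI[OF conjunct1])
      then have "card {..card S} \<le> card S" by (rule card_inj_on_le[OF inj _ S(1)])
      then show False by simp
    qed
    then obtain a b where "a \<le> card S" "b \<le> card S" "f a = f b" "a \<noteq> b"
      unfolding inj_on_def by blast
    then have "\<exists>i j. i < j \<and> j \<le> card S \<and> f i = f j"
      by (cases "a < b") (blast, metis linorder_neqE_nat)
    then obtain i j where ij: "i < j" "j \<le> card S" "f i = f j" by blast
    have "- (u ^ i - f i) \<in> Mpow v \<pi> m" using f[of i] by (simp only: Mpow_minus)
    then have "(u ^ j - f j) + - (u ^ i - f i) \<in> Mpow v \<pi> m"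
      by (rule Mpow_add[OF conjunct2[OF f]])
    also have "(u ^ j - f j) + - (u ^ i - f i) = u ^ j - u ^ i" using ij by simp
    finally have "u ^ j / u ^ i \<in> ounits m"
      by (simp only: ounits_iff_div[OF units_power[OF u] units_power[OF u]])
    moreover have "u ^ (j - i) = u ^ j / u ^ i"
      using ij units_nz[OF u] by (intro power_diff) auto
    ultimately have "u ^ (j - i) \<in> ounits m" by simp
    then have *: "(u ^ (j - i)) ^ k \<in> ounits m" for k by (rule ounits_power)
    have "(j - i) dvd (fact (card S) :: nat)" by (rule dvd_fact) (use ij in auto)
    then obtain k where "fact (card S) = (j - i) * k" unfolding dvd_def ..
    then have "u ^ fact (card S) = (u ^ (j - i)) ^ k" using power_mult[of u "j - i" k] by (rule ssubst)
    then show ?thesis using *[of k] by (rule ssubst)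
  qed
  have "unit_exponent m (fact (card S))"
    unfolding unit_exponent_def by (intro conjI ballI fact_gt_zero *)
  then show ?thesis ..
qed

section \<open>Existence and uniqueness of the angular component map\<close>

lemma decomp_unique_aux:
  assumes "d < E" "w \<noteq> 0" "t \<in> units v" "\<pi> ^ d * w ^ E * t = 1"
  shows "d = 0 \<and> w \<in> units v"
proof -
  have "v (\<pi> ^ d * w ^ E * t) = 0" using assms by simp
  moreover have "v (\<pi> ^ d * w ^ E * t) = gmul (int d) (v \<pi>) + gmul (int E) (v w)"
    using assms(2) assms(3)[unfolded units_iff] by (simp add: v_mult v_power)
  ultimately have "gmul (int d) (v \<pi>) + gmul (int E) (v w) = 0" by simp
  \<comment> \<open>So d times the smallest positive order is E times \<open>- v w\<close>. A
    positive \<open>- v w\<close> would make the right side at least E times that order, which is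
    too large since d < E; a negative one would make it negative.\<close>
  then have *: "gmul (int d) (v \<pi>) = gmul (int E) (- v w)"
    unfolding gmul_minus by (rule eq_neg_iff_add_eq_0[THEN iffD2])
  have E: "gmul (int E) (v \<pi>) = gmul (int d) (v \<pi>) + gmul (int (E - d)) (v \<pi>)"
    using assms(1) gmul_add[of d "E - d" "v \<pi>"] by simp
  have "\<not> 0 < - v w"
  proof
    assume "0 < - v w"
    then have "v \<pi> \<le> - v w" using v_pi_least[of "inverse w"] assms(2) v_inverse by simp
    then show False using * gmul_mono[of "v \<pi>" "- v w" E] E gmul_pos[OF v_pi_pos, of "E - d"] assms(1)
      by simp
  qed
  then have "0 \<le> v w" by simp
  have "gmul (int d) (v \<pi>) \<le> 0" using * gmul_mono[of "- v w" 0 E] \<open>0 \<le> v w\<close>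
    by (simp add: gmul_zero_right)
  then have "d = 0" using gmul_pos[OF v_pi_pos, of d] by (cases "d = 0") auto
  then have "gmul (int E) (v w) = 0" using * by (simp add: gmul_zero gmul_minus)
  then have "\<not> 0 < v w" using gmul_pos[of "v w" E] assms(1) by auto
  then have "v w = 0" using \<open>0 \<le> v w\<close> by simp
  then show ?thesis using \<open>d = 0\<close> assms(2) by (simp add: units_def)
qed

text \<open>Comparing orders gives \<open>r = s\<close> and shows that \<open>z / y\<close> is a
  unit. Then \<open>u / w\<close> is the \<open>E\<close>-th power of a unit, hence trivial modulo
  \<pi>^m.\<close>

lemma decomp_unique_le:
  assumes "unit_exponent m E" "r \<le> s" "s < E" "y \<noteq> 0" "z \<noteq> 0" "u \<in> units v" "w \<in> units v"
    and eq: "\<pi> ^ r * y ^ E * u = \<pi> ^ s * z ^ E * w"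
  shows "resclass v \<pi> m u = resclass v \<pi> m w"
proof -
  have "\<pi> ^ s = \<pi> ^ r * \<pi> ^ (s - r)" using assms(2) by (simp add: power_add[symmetric])
  then have "y ^ E * u = \<pi> ^ (s - r) * z ^ E * w" using eq by (simp add: mult.assoc)
  then have eq': "\<pi> ^ (s - r) * (z / y) ^ E * (w / u) = 1"
    using assms(4,5) units_nz[OF assms(6)] units_nz[OF assms(7)] by (simp add: field_simps)
  have "s - r = 0 \<and> z / y \<in> units v"
    by (rule decomp_unique_aux[OF _ _ _ eq']) (use assms in \<open>auto simp: units_divide\<close>)
  moreover from this have "u / w = (z / y) ^ E"
    using eq' units_nz[OF assms(6)] units_nz[OF assms(7)] by (simp add: field_simps)
  ultimately show ?thesis
    using assms(1,6,7) by (simp add: resclass_units_eq_iff unit_exponent_def)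
qed

lemma decomp_unique:
  assumes "unit_exponent m E" "r < E" "s < E" "y \<noteq> 0" "z \<noteq> 0" "u \<in> units v" "w \<in> units v"
    and eq: "\<pi> ^ r * y ^ E * u = \<pi> ^ s * z ^ E * w"
  shows "resclass v \<pi> m u = resclass v \<pi> m w"
proof (cases "r \<le> s")
  case True
  then show ?thesis using decomp_unique_le[OF assms(1) _ assms(3-8)] by simp
next
  case False
  then show ?thesis
    using decomp_unique_le[OF assms(1) _ assms(2,5,4,7,6) eq[symmetric]] by simp
qed

lemma resclass_mult_cong:
  assumes "u \<in> units v" "w \<in> units v" "u' \<in> units v" "w' \<in> units v"
    "resclass v \<pi> m u = resclass v \<pi> m u'" "resclass v \<pi> m w = resclass v \<pi> m w'"
  shows "resclass v \<pi> m (u * w) = resclass v \<pi> m (u' * w')"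
proof -
  have "(u / u') * (w / w') \<in> ounits m"
    using assms by (intro ounits_mult) (simp_all add: resclass_units_eq_iff)
  then show ?thesis using assms by (simp add: resclass_units_eq_iff units_mult)
qed

text \<open>Any angular component kills \<open>\<pi> ^ r\<close> by normalisation and
  \<open>y ^ E\<close> by the choice of \<open>E\<close>, so its value is forced to be the class of
  \<open>u\<close>. This yields uniqueness and also suggests the construction.\<close>

lemma is_ac_decomp:
  assumes f: "is_ac v \<pi> m f" and E: "unit_exponent m E"
    and "y \<noteq> 0" "u \<in> units v"
  shows "f (\<pi> ^ r * y ^ E * u) = resclass v \<pi> m u"
proof -
  have hom: "f (a * b) = resclass v \<pi> m (c * d)" if "a \<noteq> 0" "b \<noteq> 0" "c \<in> units v" "d \<in> units v"
    "f a = resclass v \<pi> m c" "f b = resclass v \<pi> m d" for a b c d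
    using f that unfolding is_ac_def by blast
  have unit: "f w = resclass v \<pi> m w" if "w \<in> units v" for w
    using f that unfolding is_ac_def by blast
  have pow: "f (a ^ n) = resclass v \<pi> m (c ^ n)" if "a \<noteq> 0" "c \<in> units v" "f a = resclass v \<pi> m c" for a c n
  proof (induction n)
    case (Suc n)
    then show ?case using hom[of a "a ^ n" c "c ^ n"] that units_power by simp
  qed (simp add: unit units_one)
  obtain c where c: "c \<in> units v" "f y = resclass v \<pi> m c"
    using f assms(3) unfolding is_ac_def by blast
  have "c ^ E \<in> ounits m" using E c by (simp add: unit_exponent_def)
  then have "resclass v \<pi> m (c ^ E) = resclass v \<pi> m 1"
    using c by (simp add: resclass_units_eq_iff units_power units_one)
  then have "f (y ^ E) = resclass v \<pi> m 1" using pow c assms(3) by simp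
  moreover have "f (\<pi> ^ r) = resclass v \<pi> m 1"
    using pow[of \<pi> 1 r] f units_one unfolding is_ac_def by simp
  ultimately have "f (\<pi> ^ r * y ^ E) = resclass v \<pi> m 1"
    using hom[of "\<pi> ^ r" "y ^ E" 1 1] units_one assms(3) by simp
  then show ?thesis
    using hom[of "\<pi> ^ r * y ^ E" u 1 u] unit assms(3,4) units_one units_nz by simp
qed

lemma ex1_ac: "\<exists>!f. is_ac v \<pi> m f"
proof -
  obtain E where E: "unit_exponent m E" using ex_unit_exponent by blast
  then have E0: "0 < E" by (simp add: unit_exponent_def)
  define rep where "rep x u \<longleftrightarrow> u \<in> units v \<and> (\<exists>r<E. \<exists>y. y \<noteq> 0 \<and> x = \<pi> ^ r * y ^ E * u)" for x u
  define f where "f x = (if x = 0 then {} else resclass v \<pi> m (SOME u. rep x u))" for x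
  have repI: "rep x u" if "r < E" "y \<noteq> 0" "u \<in> units v" "x = \<pi> ^ r * y ^ E * u" for r y u x
    using that unfolding rep_def by blast
  have uniq: "resclass v \<pi> m u = resclass v \<pi> m w" if u: "rep x u" and w: "rep x w" for x u w
  proof -
    obtain r y where "r < E" "y \<noteq> 0" "x = \<pi> ^ r * y ^ E * u"
      using u unfolding rep_def by blast
    moreover obtain s z where "s < E" "z \<noteq> 0" "x = \<pi> ^ s * z ^ E * w"
      using w unfolding rep_def by blast
    ultimately show ?thesis
      using decomp_unique[OF E, of r s y z u w] u w by (simp add: rep_def)
  qed
  have f: "f x = resclass v \<pi> m u" if "rep x u" for x u
  proof -
    have "rep x (SOME u. rep x u)" using that by (rule someI)
    then have "resclass v \<pi> m (SOME u. rep x u) = resclass v \<pi> m u"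
      by (rule uniq) (rule that)
    moreover have "x \<noteq> 0" using that by (auto simp: rep_def units_nz)
    ultimately show ?thesis by (simp add: f_def)
  qed
  have ex: "\<exists>u. rep x u" if nz: "x \<noteq> 0" for x
  proof -
    obtain r y u where "r < E" "y \<noteq> 0" "u \<in> units v" "x = \<pi> ^ r * y ^ E * u"
      by (rule pi_power_decomp[OF E0 nz])
    then show ?thesis unfolding rep_def by blast
  qed
  have "is_ac v \<pi> m f"
    unfolding is_ac_def
  proof (intro conjI allI impI ballI)
    show "f 0 = {}" by (simp add: f_def)
    show "\<exists>u\<in>units v. f x = resclass v \<pi> m u" if nz: "x \<noteq> 0" for x
    proof -
      obtain u where u: "rep x u" using ex[OF nz] by blast
      then have "u \<in> units v" by (simp add: rep_def)
      then show ?thesis using f[OF u] by (rule bexI[rotated])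
    qed
    have rep_unit: "rep u u" if "u \<in> units v" for u
      by (rule repI[of 0 1]) (use that E0 in auto)
    show "f u = resclass v \<pi> m u" if "u \<in> units v" for u
      by (rule f[OF rep_unit[OF that]])
    have "rep \<pi> 1"
    \<comment> \<open>The exponent of \<pi> in a representation must be below \<open>E\<close>, so
      for \<open>E = 1\<close> the element \<pi> has to enter through the \<open>E\<close>-th
      power.\<close>
    proof (cases "E = 1")
      case True
      then show ?thesis by (intro repI[of 0 \<pi>]) (auto simp: units_one)
    next
      case False
      then show ?thesis using E0 by (intro repI[of 1 1]) (auto simp: units_one)
    qed
    then show "f \<pi> = resclass v \<pi> m 1" by (rule f)
    fix x y u w
    assume *: "x \<noteq> 0" "y \<noteq> 0" "u \<in> units v" "w \<in> units v"
      "f x = resclass v \<pi> m u" "f y = resclass v \<pi> m w"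
    obtain u' r a where a: "u' \<in> units v" "r < E" "a \<noteq> 0" "x = \<pi> ^ r * a ^ E * u'"
      using ex[OF *(1)] unfolding rep_def by blast
    obtain w' s b where b: "w' \<in> units v" "s < E" "b \<noteq> 0" "y = \<pi> ^ s * b ^ E * w'"
      using ex[OF *(2)] unfolding rep_def by blast
    have xy: "x * y = \<pi> ^ (r + s) * (a * b) ^ E * (u' * w')"
      using a b by (simp add: power_add power_mult_distrib)
    have "rep (x * y) (u' * w')"
    proof (cases "r + s < E")
      case True
      then show ?thesis using xy a b units_mult by (intro repI[of "r + s" "a * b"]) auto
    next
      case False
      \<comment> \<open>When the exponents add up to at least \<open>E\<close>, a factor
        \<open>\<pi> ^ E\<close> is carried over into the \<open>E\<close>-th power.\<close>
      have "\<pi> ^ (r + s) = \<pi> ^ (r + s - E) * \<pi> ^ E"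
        using False by (simp add: power_add[symmetric])
      then have "x * y = \<pi> ^ (r + s - E) * (\<pi> * a * b) ^ E * (u' * w')"
        using xy by (simp add: power_mult_distrib)
      then show ?thesis using a b units_mult
        by (intro repI[of "r + s - E" "\<pi> * a * b"]) auto
    qed
    then have "f (x * y) = resclass v \<pi> m (u' * w')" by (rule f)
    moreover have "rep x u'" by (rule repI[OF a(2,3,1,4)])
    then have "resclass v \<pi> m u' = resclass v \<pi> m u" using f *(5) by simp
    moreover have "rep y w'" by (rule repI[OF b(2,3,1,4)])
    then have "resclass v \<pi> m w' = resclass v \<pi> m w" using f *(6) by simp
    ultimately show "f (x * y) = resclass v \<pi> m (u * w)"
      using resclass_mult_cong[OF a(1) b(1) *(3,4)] by simp
  qed
  moreover have "g = f" if g: "is_ac v \<pi> m g" for g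
  proof
    fix x
    show "g x = f x"
    proof (cases "x = 0")
      case True
      then show ?thesis using g by (simp add: is_ac_def f_def)
    next
      case False
      then obtain u where u: "rep x u" using ex by blast
      then obtain r y where "y \<noteq> 0" "x = \<pi> ^ r * y ^ E * u" unfolding rep_def by blast
      then have "g x = resclass v \<pi> m u"
        using is_ac_decomp[OF g E, of y u r] u by (simp add: rep_def)
      then show ?thesis using f[OF u] by simp
    qed
  qed
  ultimately show ?thesis by blast
qed

lemma ac_decomp:
  assumes "unit_exponent m E" "y \<noteq> 0" "u \<in> units v"
  shows "ac v \<pi> m (\<pi> ^ r * y ^ E * u) = resclass v \<pi> m 1 \<longleftrightarrow> u \<in> ounits m"
proof -
  have "is_ac v \<pi> m (ac v \<pi> m)" unfolding ac_def by (rule theI'[OF ex1_ac])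
  from is_ac_decomp[OF this assms] show ?thesis
    using assms by (simp add: resclass_units_eq_iff units_one)
qed

section \<open>The kernel of the angular component\<close>

definition acone :: "nat \<Rightarrow> 'k \<Rightarrow> bool" where
  "acone m x \<longleftrightarrow> x \<noteq> 0 \<and> ac v \<pi> m x = resclass v \<pi> m 1"

lemma acone_nz: "acone m x \<Longrightarrow> x \<noteq> 0"
  by (simp add: acone_def)

lemma acone_decomp:
  assumes "unit_exponent m E" "y \<noteq> 0" "u \<in> units v"
  shows "acone m (\<pi> ^ r * y ^ E * u) \<longleftrightarrow> u \<in> ounits m"
  using ac_decomp[OF assms] assms(2) units_nz[OF assms(3)] by (simp add: acone_def)

lemma acone_unit:
  assumes "u \<in> units v"
  shows "acone m u \<longleftrightarrow> u \<in> ounits m"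
proof -
  obtain E where "unit_exponent m E" using ex_unit_exponent ..
  from acone_decomp[OF this _ assms, of 1 0] show ?thesis by simp
qed

lemma unit_exponent_pos: "unit_exponent m E \<Longrightarrow> 0 < E"
  by (simp add: unit_exponent_def)

lemma acone_mult:
  assumes "acone m x" "acone m y"
  shows "acone m (x * y)"
proof -
  obtain E where E: "unit_exponent m E" using ex_unit_exponent ..
  obtain r a u where x: "r < E" "a \<noteq> 0" "u \<in> units v" "x = \<pi> ^ r * a ^ E * u"
    by (rule pi_power_decomp[OF unit_exponent_pos[OF E] acone_nz[OF assms(1)]])
  obtain s b w where y: "s < E" "b \<noteq> 0" "w \<in> units v" "y = \<pi> ^ s * b ^ E * w"
    by (rule pi_power_decomp[OF unit_exponent_pos[OF E] acone_nz[OF assms(2)]])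
  have "u * w \<in> ounits m"
    using assms x y acone_decomp[OF E] by (intro ounits_mult) simp_all
  then have "acone m (\<pi> ^ (r + s) * (a * b) ^ E * (u * w))"
    using acone_decomp[OF E, of "a * b" "u * w" "r + s"] x y units_mult by simp
  moreover have "x * y = \<pi> ^ (r + s) * (a * b) ^ E * (u * w)"
    using x y by (simp add: power_add power_mult_distrib)
  ultimately show ?thesis by (simp only:)
qed

lemma acone_inverse:
  assumes "0 < m" "acone m x"
  shows "acone m (inverse x)"
proof -
  obtain E where E: "unit_exponent m E" using ex_unit_exponent ..
  obtain r a u where x: "r < E" "a \<noteq> 0" "u \<in> units v" "x = \<pi> ^ r * a ^ E * u"
    by (rule pi_power_decomp[OF unit_exponent_pos[OF E] acone_nz[OF assms(2)]])
  have "u \<in> ounits m" using assms x acone_decomp[OF E] by simp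
  then have "inverse u \<in> ounits m" by (rule ounits_inverse[OF assms(1)])
  then have "acone m (\<pi> ^ (E - r) * (inverse (\<pi> * a)) ^ E * inverse u)"
    using acone_decomp[OF E, of "inverse (\<pi> * a)" "inverse u" "E - r"] x units_inverse by simp
  \<comment> \<open>The inverse of \<open>\<pi> ^ r\<close> is \<open>\<pi> ^ (E - r)\<close> times
    the inverse of \<open>\<pi> ^ E\<close>; this keeps all exponents natural numbers.\<close>
  moreover have "\<pi> ^ E = \<pi> ^ (E - r) * \<pi> ^ r" using x(1) by (simp add: power_add[symmetric])
  then have "inverse x = \<pi> ^ (E - r) * (inverse (\<pi> * a)) ^ E * inverse u"
    using x by (simp add: power_mult_distrib power_inverse)
  ultimately show ?thesis by (simp only:)
qed

text \<open>The product of exponents for the two levels is an exponent for both, so a single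
  decomposition of \<open>x\<close> tests both kernels.\<close>

lemma acone_mono:
  assumes "m \<le> M" "acone M x"
  shows "acone m x"
proof -
  obtain E1 where E1: "unit_exponent m E1" using ex_unit_exponent ..
  obtain E2 where E2: "unit_exponent M E2" using ex_unit_exponent ..
  define E where "E = E1 * E2"
  have pos: "0 < E" using unit_exponent_pos[OF E1] unit_exponent_pos[OF E2] by (simp add: E_def)
  have E: "unit_exponent m E" "unit_exponent M E"
    using unit_exponent_dvd[OF E1 _ pos] unit_exponent_dvd[OF E2 _ pos] by (simp_all add: E_def)
  obtain r a u where x: "r < E" "a \<noteq> 0" "u \<in> units v" "x = \<pi> ^ r * a ^ E * u"
    by (rule pi_power_decomp[OF pos acone_nz[OF assms(2)]])
  then show ?thesis using assms acone_decomp[OF E(1)] acone_decomp[OF E(2)] ounits_mono by simp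
qed

section \<open>The groups \<open>Qnm\<close> and their cosets\<close>

abbreviation Q :: "nat \<Rightarrow> nat \<Rightarrow> 'k set" where "Q \<equiv> Qnm v \<pi>"
abbreviation sQ :: "'k \<Rightarrow> nat \<Rightarrow> nat \<Rightarrow> 'k set" where "sQ \<equiv> scaleQ v \<pi>"

lemma Q_iff:
  assumes "0 < m"
  shows "x \<in> Q n m \<longleftrightarrow> (\<exists>y w. y \<noteq> 0 \<and> w \<in> ounits m \<and> x = y ^ n * w) \<and> acone m x"
proof
  assume "x \<in> Q n m"
  then obtain y z where y: "y \<noteq> 0" "z \<in> Mpow v \<pi> m" "x = y ^ n * (1 + z)"
    "ac v \<pi> m x = resclass v \<pi> m 1"
    unfolding Qnm_def Pn_def by auto
  then have w: "1 + z \<in> ounits m" by (simp add: ounits_def)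
  then have "x \<noteq> 0" using y units_nz[OF ounits_units[OF assms w]] by simp
  then show "(\<exists>y w. y \<noteq> 0 \<and> w \<in> ounits m \<and> x = y ^ n * w) \<and> acone m x"
    using y w unfolding acone_def by blast
next
  assume "(\<exists>y w. y \<noteq> 0 \<and> w \<in> ounits m \<and> x = y ^ n * w) \<and> acone m x"
  then obtain y w where y: "y \<noteq> 0" "w \<in> ounits m" "x = y ^ n * w" "acone m x" by blast
  then have "y ^ n \<in> Pn n" "w - 1 \<in> Mpow v \<pi> m" "x = y ^ n * (1 + (w - 1))"
    by (auto simp: Pn_def ounits_def)
  then show "x \<in> Q n m" using y(4) unfolding Qnm_def acone_def by blast
qed

lemma Q_nz: "0 < m \<Longrightarrow> x \<in> Q n m \<Longrightarrow> x \<noteq> 0"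
  by (simp add: Q_iff acone_def)

lemma Q_mult:
  assumes m: "0 < m" and "x \<in> Q n m" "y \<in> Q n m"
  shows "x * y \<in> Q n m"
proof -
  obtain a u where x: "a \<noteq> 0" "u \<in> ounits m" "x = a ^ n * u" "acone m x"
    using assms(2) unfolding Q_iff[OF m] by blast
  obtain b w where y: "b \<noteq> 0" "w \<in> ounits m" "y = b ^ n * w" "acone m y"
    using assms(3) unfolding Q_iff[OF m] by blast
  have "a * b \<noteq> 0" "u * w \<in> ounits m" "x * y = (a * b) ^ n * (u * w)"
    using x y ounits_mult by (simp_all add: power_mult_distrib)
  then show ?thesis unfolding Q_iff[OF m] using acone_mult[OF x(4) y(4)] by blast
qed

lemma Q_inverse:
  assumes m: "0 < m" and "x \<in> Q n m"
  shows "inverse x \<in> Q n m"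
proof -
  obtain a u where x: "a \<noteq> 0" "u \<in> ounits m" "x = a ^ n * u" "acone m x"
    using assms(2) unfolding Q_iff[OF m] by blast
  have "inverse a \<noteq> 0" "inverse u \<in> ounits m" "inverse x = (inverse a) ^ n * inverse u"
    using x ounits_inverse[OF m] by (simp_all add: power_inverse)
  then show ?thesis unfolding Q_iff[OF m] using acone_inverse[OF m x(4)] by blast
qed

lemma Q_divide: "0 < m \<Longrightarrow> x \<in> Q n m \<Longrightarrow> y \<in> Q n m \<Longrightarrow> x / y \<in> Q n m"
  using Q_mult[of m x n "inverse y"] Q_inverse[of m y n] by (simp add: divide_inverse)

lemma ounits_le_Q:
  assumes m: "0 < m" and w: "w \<in> ounits m"
  shows "w \<in> Q n m"
proof -
  have "w = 1 ^ n * w" by simp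
  moreover have "acone m w" using w by (simp add: acone_unit[OF ounits_units[OF m w]])
  ultimately show ?thesis using w zero_neq_one[symmetric] unfolding Q_iff[OF m] by blast
qed

lemma Q_mono:
  assumes m: "0 < m" and "m \<le> M" "n dvd N" "x \<in> Q N M"
  shows "x \<in> Q n m"
proof -
  have M: "0 < M" using assms by simp
  obtain a u where x: "a \<noteq> 0" "u \<in> ounits M" "x = a ^ N * u" "acone M x"
    using assms(4) unfolding Q_iff[OF M] by blast
  obtain j where "N = n * j" using assms(3) unfolding dvd_def ..
  then have "x = (a ^ j) ^ n * u" using x by (simp add: power_mult[symmetric] mult.commute)
  moreover have "a ^ j \<noteq> 0" using x by simp
  ultimately show ?thesis
    using ounits_mono[OF assms(2) x(2)] acone_mono[OF assms(2) x(4)] unfolding Q_iff[OF m] by blast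
qed

text \<open>The quotient lies in the kernel of the angular component and has order 0, so it is a
  1-unit. Thus the elements of \<open>Q n m\<close> of one given order all lie in a single small
  ball.\<close>

lemma Q_same_val:
  assumes m: "0 < m" and "x \<in> Q n m" "y \<in> Q n m" "v x = v y"
  shows "x / y \<in> ounits m"
proof -
  have "x / y \<in> Q n m" using Q_divide[OF m assms(2,3)] .
  then have "acone m (x / y)" by (simp add: Q_iff[OF m])
  moreover have "x / y \<in> units v"
    using Q_nz[OF m assms(2)] Q_nz[OF m assms(3)] assms(4) by (simp add: units_def v_divide)
  ultimately show ?thesis by (simp add: acone_unit)
qed

text \<open>The element is an \<open>n\<close>-th power, and being also an \<open>E\<close>-th power
  it has trivial angular component.\<close>

lemma Q_power:
  assumes m: "0 < m" and E: "unit_exponent m E" and "y \<noteq> 0"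
  shows "y ^ (n * E) \<in> Q n m"
proof -
  have "acone m (\<pi> ^ 0 * (y ^ n) ^ E * 1)"
    using assms(3) by (subst acone_decomp[OF E]) (simp_all add: units_one ounits_one)
  then have "acone m (y ^ (n * E))" by (simp add: power_mult)
  moreover have "y ^ (n * E) = (y ^ E) ^ n * 1" by (simp add: power_mult[symmetric] mult.commute)
  moreover have "y ^ E \<noteq> 0" using assms(3) by simp
  ultimately show ?thesis using ounits_one unfolding Q_iff[OF m] by blast
qed

lemma sQ_zero: "0 < m \<Longrightarrow> x \<in> sQ 0 n m \<longleftrightarrow> x = 0"
  using ounits_le_Q[OF _ ounits_one] by (auto simp: scaleQ_def)

lemma sQ_iff: "l \<noteq> 0 \<Longrightarrow> x \<in> sQ l n m \<longleftrightarrow> x / l \<in> Q n m"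
  by (force simp: scaleQ_def)

lemma sQ_nz: "0 < m \<Longrightarrow> l \<noteq> 0 \<Longrightarrow> x \<in> sQ l n m \<Longrightarrow> x \<noteq> 0"
  using Q_nz[of m "x / l" n] by (auto simp: sQ_iff)

lemma sQ_cong_imp:
  assumes m: "0 < m" and "y \<noteq> 0" "x / y \<in> Q n m" "y \<in> sQ l n m"
  shows "x \<in> sQ l n m"
proof -
  have l: "l \<noteq> 0"
  proof
    assume "l = 0"
    then show False using assms(2,4) sQ_zero[OF m] by simp
  qed
  have "(x / y) * (y / l) \<in> Q n m" using assms by (intro Q_mult) (simp_all add: sQ_iff l)
  then show ?thesis using assms(2) by (simp add: sQ_iff l)
qed

lemma sQ_cong:
  assumes m: "0 < m" and "y \<noteq> 0" "x / y \<in> Q n m"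
  shows "x \<in> sQ l n m \<longleftrightarrow> y \<in> sQ l n m"
proof -
  have "x \<noteq> 0" using Q_nz[OF m assms(3)] by auto
  moreover have "y / x \<in> Q n m" using Q_inverse[OF m assms(3)] by simp
  ultimately show ?thesis using sQ_cong_imp[OF m assms(2,3)] sQ_cong_imp[OF m, of x y] by blast
qed

lemma finite_units_mod:
  assumes m: "0 < m"
  shows "\<exists>T. finite T \<and> (\<forall>u \<in> units v. \<exists>t \<in> T. t \<in> units v \<and> u / t \<in> ounits m)"
proof -
  obtain S where S: "finite S \<and> S \<subseteq> valring v \<and> (\<forall>x \<in> valring v. \<exists>s \<in> S. x - s \<in> Mpow v \<pi> m)"
    using finite_residues[of m] ..
  \<comment> \<open>The representatives in \<open>S\<close> need not be units, so each is replaced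
    by a unit congruent to it. Where no such unit exists the choice is arbitrary, which is why the
    claim asserts \<open>t \<in> units v\<close> separately.\<close>
  define T where "T = (\<lambda>s. SOME u. u \<in> units v \<and> u - s \<in> Mpow v \<pi> m) ` S"
  show ?thesis
  proof (intro exI[of _ T] conjI ballI)
    show "finite T" using S by (simp add: T_def)
    fix u assume u: "u \<in> units v"
    then obtain s where s: "s \<in> S" "u - s \<in> Mpow v \<pi> m" using S units_valring by blast
    define t where "t = (SOME u. u \<in> units v \<and> u - s \<in> Mpow v \<pi> m)"
    have "u \<in> units v \<and> u - s \<in> Mpow v \<pi> m" using u s(2) ..
    then have t: "t \<in> units v \<and> t - s \<in> Mpow v \<pi> m" unfolding t_def by (rule someI)
    have "- (t - s) \<in> Mpow v \<pi> m" using t by (simp only: Mpow_minus)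
    from Mpow_add[OF s(2) this] have "u - t \<in> Mpow v \<pi> m" by simp
    then have "u / t \<in> ounits m" using u t by (simp add: ounits_iff_div)
    moreover have "t \<in> T" unfolding T_def t_def using s(1) by (rule imageI)
    ultimately show "\<exists>t \<in> T. t \<in> units v \<and> u / t \<in> ounits m" using t by blast
  qed
qed

text \<open>Decomposing with exponent \<open>n * E\<close> puts \<open>y ^ (n * E)\<close> into
  \<open>Q n m\<close>. There remain finitely many \<open>r\<close>, and units modulo 1-units, of
  which there are finitely many classes.\<close>

lemma finite_index:
  assumes m: "0 < m" and n: "0 < n"
  shows "\<exists>S. finite S \<and> 0 \<notin> S \<and> (\<forall>x. x \<noteq> 0 \<longrightarrow> (\<exists>s \<in> S. x \<in> sQ s n m))"
proof -
  obtain E where E: "unit_exponent m E" using ex_unit_exponent ..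
  have pos: "0 < n * E" using n unit_exponent_pos[OF E] by simp
  obtain T where T: "finite T \<and> (\<forall>u \<in> units v. \<exists>t \<in> T. t \<in> units v \<and> u / t \<in> ounits m)"
    using finite_units_mod[OF m] ..
  define S where "S = (\<lambda>(r, t). \<pi> ^ r * t) ` ({..<n * E} \<times> (T \<inter> units v))"
  show ?thesis
  proof (intro exI[of _ S] conjI allI impI)
    show "finite S" using T by (auto simp: S_def)
    show "0 \<notin> S" by (auto simp: S_def units_def)
    fix x :: 'k assume "x \<noteq> 0"
    then obtain r y u where x: "r < n * E" "y \<noteq> 0" "u \<in> units v" "x = \<pi> ^ r * y ^ (n * E) * u"
      by (rule pi_power_decomp[OF pos])
    obtain t where t: "t \<in> T" "t \<in> units v" "u / t \<in> ounits m" using T x(3) by blast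
    have "y ^ (n * E) * (u / t) \<in> Q n m"
      by (intro Q_mult[OF m] Q_power[OF m E x(2)] ounits_le_Q[OF m t(3)])
    then have "x / (\<pi> ^ r * t) \<in> Q n m" using x(4) units_nz[OF t(2)] by simp
    then have "x \<in> sQ (\<pi> ^ r * t) n m" using units_nz[OF t(2)] by (subst sQ_iff) auto
    moreover have "\<pi> ^ r * t \<in> S" using x(1) t by (auto simp: S_def)
    ultimately show "\<exists>s \<in> S. x \<in> sQ s n m" by blast
  qed
qed

lemma sQ_disjoint_or_eq:
  assumes m: "0 < m" and "s \<noteq> 0" "t \<noteq> 0" "x \<in> sQ s n m" "x \<in> sQ t n m"
  shows "sQ s n m = sQ t n m"
proof -
  have xs: "x / s \<in> Q n m" and xt: "x / t \<in> Q n m" using assms by (simp_all add: sQ_iff)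
  have "(x / t) / (x / s) \<in> Q n m" by (rule Q_divide[OF m xt xs])
  moreover have "x \<noteq> 0" using sQ_nz[OF m assms(2,4)] .
  ultimately have "s / t \<in> Q n m" by simp
  have "y \<in> sQ s n m \<longleftrightarrow> y \<in> sQ t n m" for y
  proof -
    have "y / s * (s / t) = y / t" "y / t / (s / t) = y / s" using assms(2,3) by simp_all
    then show ?thesis
      using Q_mult[OF m, of "y / s" n "s / t"] Q_divide[OF m, of "y / t" n "s / t"]
        \<open>s / t \<in> Q n m\<close> by (auto simp: sQ_iff assms(2,3))
  qed
  then show ?thesis by blast
qed

text \<open>The set from \<open>finite_index\<close> may describe one coset several times. Choosing
  one coefficient for each coset makes the cosets disjoint, as needed for disjoint cells.\<close>

lemma coset_representatives:
  assumes m: "0 < m" and n: "0 < n"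
  obtains \<Lambda> where "finite \<Lambda>" "0 \<notin> \<Lambda>" "\<forall>x. x \<noteq> 0 \<longrightarrow> (\<exists>l \<in> \<Lambda>. x \<in> sQ l n m)"
    "\<forall>l \<in> \<Lambda>. \<forall>l' \<in> \<Lambda>. l \<noteq> l' \<longrightarrow> sQ l n m \<inter> sQ l' n m = {}"
proof -
  obtain S where S: "finite S \<and> 0 \<notin> S \<and> (\<forall>x. x \<noteq> 0 \<longrightarrow> (\<exists>s \<in> S. x \<in> sQ s n m))"
    using finite_index[OF m n] ..
  define g where "g C = (SOME s. s \<in> S \<and> sQ s n m = C)" for C
  define \<Lambda> where "\<Lambda> = (\<lambda>s. g (sQ s n m)) ` S"
  have g: "g (sQ s n m) \<in> S \<and> sQ (g (sQ s n m)) n m = sQ s n m" if "s \<in> S" for s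
  proof -
    have "s \<in> S \<and> sQ s n m = sQ s n m" using that by simp
    then show ?thesis unfolding g_def by (rule someI)
  qed
  show thesis
  proof (rule that[of \<Lambda>]; (intro allI ballI impI)?)
    show "finite \<Lambda>" using S by (simp add: \<Lambda>_def)
    show "0 \<notin> \<Lambda>"
    proof
      assume "0 \<in> \<Lambda>"
      then obtain s where "s \<in> S" "0 = g (sQ s n m)" unfolding \<Lambda>_def by (rule imageE)
      then show False using g[of s] S by simp
    qed
    show "\<exists>l \<in> \<Lambda>. x \<in> sQ l n m" if "x \<noteq> 0" for x
    proof -
      obtain s where "s \<in> S" "x \<in> sQ s n m" using S \<open>x \<noteq> 0\<close> by blast
      then show ?thesis using g[of s] by (auto simp: \<Lambda>_def)
    qed
    fix l l' assume l: "l \<in> \<Lambda>" "l' \<in> \<Lambda>" "l \<noteq> l'"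
    obtain s where s: "s \<in> S" "l = g (sQ s n m)" using l(1) unfolding \<Lambda>_def by blast
    obtain s' where s': "s' \<in> S" "l' = g (sQ s' n m)" using l(2) unfolding \<Lambda>_def by blast
    show "sQ l n m \<inter> sQ l' n m = {}"
    proof (rule ccontr)
      assume "sQ l n m \<inter> sQ l' n m \<noteq> {}"
      then obtain x where x: "x \<in> sQ l n m" "x \<in> sQ l' n m" by blast
      have "l \<noteq> 0" "l' \<noteq> 0" using s s' g S by metis+
      from sQ_disjoint_or_eq[OF m this x] have "sQ s n m = sQ s' n m"
        using g[OF s(1)] g[OF s'(1)] s(2) s'(2) by simp
      then show False using l(3) s(2) s'(2) by simp
    qed
  qed
qed

section \<open>Perturbation: comparison of \<open>s\<close> and \<open>s + d\<close>\<close>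

lemma close_div:
  assumes "b \<noteq> 0"
  shows "a / b \<in> ounits m \<longleftrightarrow> \<not> olt (a - b) (b * \<pi> ^ m)"
proof -
  have "a - b = b * (a / b - 1)" using assms by (simp add: field_simps)
  then show ?thesis using Mpow_mult_cancel[OF assms, of "a / b - 1" m] by (simp add: ounits_def)
qed

text \<open>If \<open>a\<close> and \<open>b\<close> agree to relative precision \<pi>^m, their
  quotient is a 1-unit. Hence they agree in all that a cell condition can detect: order and
  coset.\<close>

lemma close_imp:
  assumes m: "0 < m" and b: "b \<noteq> 0" and "\<not> olt (a - b) (b * \<pi> ^ m)"
  shows "a \<noteq> 0" "v a = v b" "a \<in> sQ l n m \<longleftrightarrow> b \<in> sQ l n m"
proof -
  have *: "a / b \<in> ounits m" using assms by (simp add: close_div)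
  have u: "a / b \<in> units v" by (rule ounits_units[OF m *])
  show a: "a \<noteq> 0" using units_nz[OF u] by auto
  show "v a = v b" using u a b by (simp add: units_def v_divide)
  show "a \<in> sQ l n m \<longleftrightarrow> b \<in> sQ l n m"
    by (rule sQ_cong[OF m b ounits_le_Q[OF m *]])
qed

lemma pi_power_le: "m \<le> M \<Longrightarrow> \<not> olt (\<pi> ^ M * a) (\<pi> ^ m * a)"
proof -
  assume "m \<le> M"
  then have "\<pi> ^ M \<in> Mpow v \<pi> m" by (rule Mpow_mono) (simp add: Mpow_iff olt_neqs)
  then show ?thesis
    using olt_mult_cancel[of a "\<pi> ^ M" "\<pi> ^ m"] by (cases "a = 0") (simp_all add: Mpow_iff olt_neqs mult.commute)
qed

lemma pi_power_less:
  assumes "i < j" "a \<noteq> 0"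
  shows "olt (\<pi> ^ i * a) (\<pi> ^ j * a)"
proof -
  have "olt (\<pi> ^ i * a) (\<pi> ^ Suc i * a)" using pi_olt[of "\<pi> ^ i * a"] assms(2) by (simp add: mult.assoc)
  moreover have "\<not> olt (\<pi> ^ j * a) (\<pi> ^ Suc i * a)" using assms(1) by (intro pi_power_le) simp
  ultimately show ?thesis by (rule olt_le_trans)
qed

text \<open>Cells offer only strict bounds. By discreteness, two strict bounds placed one step below
  and one step above pin down the order exactly.\<close>

lemma val_eq_iff: "olt (a / \<pi>) s \<and> olt s (\<pi> * a) \<longleftrightarrow> a \<noteq> 0 \<and> s \<noteq> 0 \<and> v s = v a"
proof (cases "a = 0 \<or> s = 0")
  case True
  then show ?thesis by (auto simp: olt_neqs)
next
  case False
  then have "olt (a / \<pi>) s \<longleftrightarrow> \<not> olt s a" "olt s (\<pi> * a) \<longleftrightarrow> \<not> olt a s"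
    using olt_iff_not_olt_pi[of "a / \<pi>" s] olt_iff_not_olt_pi[of a s] by simp_all
  then show ?thesis using False by (auto simp: ordlt_def)
qed

text \<open>To be read with s = t - c1 and d = c1 - c2, so that s + d = t - c2. The order of
  \<open>s\<close> exceeds that of \<open>d\<close> by more than \<open>m\<close>, so
  \<open>s + d\<close> is a perturbation of \<open>d\<close> covered by
  \<open>close_imp\<close>.\<close>

lemma near_close:
  assumes "olt (\<pi> ^ L * d) s" "m \<le> L" "0 < m"
  shows "d \<noteq> 0" "s + d \<noteq> 0" "v (s + d) = v d" "s + d \<in> sQ l n m \<longleftrightarrow> d \<in> sQ l n m"
proof -
  show d: "d \<noteq> 0" using olt_neqs(1)[OF assms(1)] by simp
  have "olt (\<pi> ^ m * d) s" using le_olt_trans[OF pi_power_le[OF assms(2)] assms(1)] .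
  then have *: "\<not> olt (s + d - d) (d * \<pi> ^ m)"
    using olt_trans[of "\<pi> ^ m * d" s "\<pi> ^ m * d"] olt_neqs(4) by (auto simp: mult.commute)
  from close_imp[OF assms(3) d *]
  show "s + d \<noteq> 0" "v (s + d) = v d" "s + d \<in> sQ l n m \<longleftrightarrow> d \<in> sQ l n m" by auto
qed

text \<open>The mirror image of \<open>near_close\<close>, with \<open>d\<close> perturbing
  \<open>s\<close>. The case \<open>d = 0\<close> is included: the hypothesis then says only that
  \<open>s\<close> is nonzero.\<close>

lemma far_close:
  assumes "olt s (d / \<pi> ^ L)" "m \<le> L" "0 < m"
  shows "s \<noteq> 0" "s + d \<noteq> 0" "v (s + d) = v s" "s + d \<in> sQ l n m \<longleftrightarrow> s \<in> sQ l n m"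
proof -
  show s: "s \<noteq> 0" using olt_neqs(1)[OF assms(1)] .
  have "olt (\<pi> ^ L * s) d"
    using assms(1) olt_mult_cancel[of "\<pi> ^ L" s "d / \<pi> ^ L"] by simp
  then have "olt (\<pi> ^ m * s) d" using le_olt_trans[OF pi_power_le[OF assms(2)]] by blast
  then have *: "\<not> olt (s + d - s) (s * \<pi> ^ m)"
    using olt_trans[of "\<pi> ^ m * s" d "\<pi> ^ m * s"] olt_neqs(4) by (auto simp: mult.commute)
  from close_imp[OF assms(3) s *]
  show "s + d \<noteq> 0" "v (s + d) = v s" "s + d \<in> sQ l n m \<longleftrightarrow> s \<in> sQ l n m" by auto
qed

lemma far_not_near:
  assumes "olt s (d / \<pi> ^ L)"
  shows "\<not> olt (\<pi> ^ L * d) s"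
proof
  assume "olt (\<pi> ^ L * d) s"
  with assms have "olt (\<pi> ^ L * d) (d / \<pi> ^ L)" using olt_trans by blast
  moreover have "\<pi> ^ L * d = \<pi> ^ (2 * L) * (d / \<pi> ^ L)" "d / \<pi> ^ L = \<pi> ^ 0 * (d / \<pi> ^ L)"
    by (simp_all add: mult_2 power_add)
  ultimately show False using pi_power_le[of 0 "2 * L" "d / \<pi> ^ L"] by simp
qed

text \<open>Used with \<open>e = d / \<pi> ^ L\<close> and \<open>M = 2 * L\<close>: by discreteness
  only finitely many orders remain between the two bounds.\<close>

lemma middle_val:
  assumes "s \<noteq> 0" "\<not> olt s e" "\<not> olt (\<pi> ^ M * e) s"
  shows "e \<noteq> 0" "\<exists>i\<le>M. v s = v (\<pi> ^ i * e)"
proof -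
  show e: "e \<noteq> 0" using assms(1,2) by (auto simp: ordlt_def)
  have "v (s / e) = v s - v e" "v (\<pi> ^ M * e) = v (\<pi> ^ M) + v e" using assms(1) e
    by (simp_all add: v_divide v_mult)
  moreover have "v e \<le> v s" "v s \<le> v (\<pi> ^ M * e)"
    using assms e by (auto simp: ordlt_def)
  ultimately have "0 \<le> v (s / e)" "v (s / e) \<le> v (\<pi> ^ M)" by (simp_all add: diff_le_eq)
  moreover have "v (\<pi> ^ M) < v (\<pi> ^ Suc M)" using v_pi_pos by (simp add: v_mult)
  ultimately have "\<exists>i<Suc M. v (s / e) = v (\<pi> ^ i)" using assms(1) e by (intro v_between) auto
  then obtain i where i: "i < Suc M" "v (s / e) = v (\<pi> ^ i)" by blast
  have "v s = v (s / e) + v e" using assms(1) e by (simp add: v_divide)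
  also have "\<dots> = v (\<pi> ^ i * e)" using i e by (simp add: v_mult)
  finally show "\<exists>i\<le>M. v s = v (\<pi> ^ i * e)" using i(1) by (intro exI[of _ i]) simp
qed

text \<open>\<open>Q N M\<close> is a subgroup of \<open>Q n m\<close>, so a coset of the former
  lies in every coset of the latter that it meets.\<close>

lemma sQ_subset:
  assumes m: "0 < m" and "m \<le> M" "n dvd N" and l: "l \<noteq> 0" and s: "s \<in> sQ l N M" "s \<in> sQ l' n m"
  shows "sQ l N M \<subseteq> sQ l' n m"
proof
  fix t assume t: "t \<in> sQ l N M"
  have M: "0 < M" using assms by simp
  have sl: "s / l \<in> Q N M" and tl: "t / l \<in> Q N M" using s(1) t by (simp_all add: sQ_iff l)
  have "(t / l) / (s / l) \<in> Q N M" by (rule Q_divide[OF M tl sl])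
  then have "t / s \<in> Q N M" using l by simp
  then have "t / s \<in> Q n m" by (rule Q_mono[OF m assms(2,3)])
  with sQ_cong_imp[OF m sQ_nz[OF M l s(1)]] s(2) show "t \<in> sQ l' n m" by blast
qed

lemma sQ_same_val:
  assumes m: "0 < m" and l: "l \<noteq> 0" and s: "s \<in> sQ l n m" "t \<in> sQ l n m" "v s = v t"
  shows "\<not> olt (s - t) (t * \<pi> ^ m)"
proof -
  have nz: "s \<noteq> 0" "t \<noteq> 0" using sQ_nz[OF m l] s by auto
  have "(s / l) / (t / l) \<in> ounits m"
    using s nz l by (intro Q_same_val[OF m, of _ n]) (simp_all add: sQ_iff v_divide)
  then show ?thesis using close_div[OF nz(2)] l by simp
qed

text \<open>On a set where both the order and the coset of \<open>t - c\<^sub>1\<close> are fixed, \<open>t - c\<^sub>1\<close> varies in a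
ball so small that the order and the coset of \<open>t - c\<^sub>2\<close> are fixed as well.\<close>
lemma middle_close:
  assumes l: "l \<noteq> 0" and m: "0 < m" and s: "s \<in> sQ l n (2 * L + m)" "s' \<in> sQ l n (2 * L + m)"
    and val: "v s = v (\<pi> ^ i * (d / \<pi> ^ L))" "v s' = v s"
    and nz: "d \<noteq> 0" "s + d \<noteq> 0" and near: "\<not> olt (\<pi> ^ L * d) (s + d)"
  shows "s' + d \<noteq> 0" "v (s' + d) = v (s + d)" "s' + d \<in> sQ k j m \<longleftrightarrow> s + d \<in> sQ k j m"
proof -
  \<comment> \<open>The precision is chosen so that ord (s' - s) \<ge> ord s + M \<ge> (ord d - L) +
    2L + m = ord d + L + m \<ge> ord (s + d) + m. The last inequality is the assumption
    \<open>near\<close>.\<close>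
  define M where "M = 2 * L + m"
  define e where "e = d / \<pi> ^ L"
  have e: "e \<noteq> 0" "d = \<pi> ^ L * e" using nz by (simp_all add: e_def)
  have M: "0 < M" using m by (simp add: M_def)
  have snz: "s \<noteq> 0" using sQ_nz[OF M l] s(1) by (simp add: M_def)
  have "\<not> olt (s' - s) (s * \<pi> ^ M)"
    using sQ_same_val[OF M l] s val(2) by (simp add: M_def)
  moreover have "\<not> olt s e"
    using pi_power_le[of 0 i e] olt_cong(1)[OF snz, of "\<pi> ^ i * e" e] val(1) e(1) by (simp add: e_def)
  then have "\<not> olt (\<pi> ^ M * s) (\<pi> ^ M * e)" by (simp add: olt_mult_cancel)
  ultimately have "\<not> olt (s' - s) (\<pi> ^ M * e)"
    by (simp add: mult.commute) (rule le_trans)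
  also have "\<pi> ^ M * e = \<pi> ^ m * (\<pi> ^ L * (\<pi> ^ L * e))"
    unfolding M_def mult_2 power_add by (simp add: mult_ac)
  also have "\<pi> ^ L * e = d" by (rule e(2)[symmetric])
  finally have "\<not> olt (s' - s) (\<pi> ^ m * (\<pi> ^ L * d))" .
  moreover have "\<not> olt (\<pi> ^ m * (\<pi> ^ L * d)) (\<pi> ^ m * (s + d))"
    using near by (simp add: olt_mult_cancel)
  ultimately have "\<not> olt (s' - s) (\<pi> ^ m * (s + d))" using le_trans by blast
  then have *: "\<not> olt (s' + d - (s + d)) ((s + d) * \<pi> ^ m)" by (simp add: mult.commute)
  from close_imp[OF m nz(2) *]
  show "s' + d \<noteq> 0" "v (s' + d) = v (s + d)" "s' + d \<in> sQ k j m \<longleftrightarrow> s + d \<in> sQ k j m" by auto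
qed

end

section \<open>Decomposition into cells\<close>

locale dist_field = FqZ q v \<pi>
  for q :: nat and v :: "'k::field \<Rightarrow> 'g::linordered_ab_group_add" and \<pi> :: 'k +
  fixes F :: "'f \<Rightarrow> 'k list \<Rightarrow> 'k"
    and R :: "'r \<Rightarrow> 'k list \<Rightarrow> bool"
  assumes Ldist: "expands_Ldist v \<pi> F R"
begin

section \<open>Order-definable functions and their closure properties\<close>

abbreviation "dp \<equiv> dpred F R"
abbreviation "vd \<equiv> vdef F R"
abbreviation "od \<equiv> order_definable v F R"

lemma od_iff: "od n f \<longleftrightarrow> dp (Suc n) (\<lambda>xs. olt (f (butlast xs)) (last xs))"
proof -
  have "xs \<in> {xs @ [t] | xs t. length xs = n \<and> olt (f xs) t} \<longleftrightarrow> olt (f (butlast xs)) (last xs)"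
    if "length xs = Suc n" for xs
    using that by (auto elim!: length_SucE)
  then show ?thesis
    unfolding order_definable_def definable_iff_dpred by (auto intro: dpred_cong)
qed

lemma od_take:
  assumes "od n f" "n \<le> N"
  shows "od N (\<lambda>xs. f (take n xs))"
  unfolding od_iff
  by (rule dpred_cong[OF dpred_take_last[OF assms(1)[unfolded od_iff] assms(2)]])
    (use assms(2) in \<open>auto elim!: length_SucE\<close>)

lemma vd_butlast: "vd n f \<Longrightarrow> vd (Suc n) (\<lambda>xs. f (butlast xs))"
  unfolding vdef_def
  by (rule dpred_cong[OF vdef_take[of F R n f "Suc n", unfolded vdef_def]])
    (auto simp: vdef_def butlast_append elim!: length_SucE)

lemma vd_last: "vd (Suc n) last"
  unfolding vdef_def
  by (rule dpred_cong[OF vdef_nth[of n "Suc n", unfolded vdef_def]])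
    (auto elim!: length_SucE simp: nth_append butlast_append)

lemma dp_olt_diff:
  assumes "vd n f" "vd n g" "vd n h" "vd n i"
  shows "dp n (\<lambda>xs. olt (f xs - g xs) (h xs - i xs))"
proof -
  obtain d where "\<And>x y z t. R d [x, y, z, t] \<longleftrightarrow> olt (x - y) (z - t)"
    using Ldist unfolding expands_Ldist_def by blast
  then show ?thesis using dpred_rel[of "[f, g, h, i]" F R n d] assms by simp
qed

lemma dp_sQ:
  assumes "vd k f" "vd k g" "0 < n" "0 < m"
  shows "dp k (\<lambda>xs. f xs - g xs \<in> sQ l n m)"
proof -
  obtain r where "\<And>x y z. R r [x, y, z] \<longleftrightarrow> y - x \<in> sQ z n m"
    using Ldist assms(3,4) unfolding expands_Ldist_def by blast
  then show ?thesis using dpred_rel[of "[g, f, \<lambda>_. l]" F R k r] assms by (simp add: vdef_const)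
qed

text \<open>The condition ord (f - g) < ord t is the instance of the relation D4 at (f, g, t, 0).
  Subtraction itself need not be definable in the language; only the order of the difference
  is.\<close>

lemma od_diff:
  assumes "vd n f" "vd n g"
  shows "od n (\<lambda>xs. f xs - g xs)"
  using dp_olt_diff[OF vd_butlast[OF assms(1)] vd_butlast[OF assms(2)] vd_last vdef_const[of F R _ 0]]
  unfolding od_iff by simp

lemma vd_imp_od: "vd n f \<Longrightarrow> od n f"
  using od_diff[of n f "\<lambda>_. 0"] by (simp add: vdef_const)

lemma dp_olt:
  assumes "od n f" "od n g"
  shows "dp n (\<lambda>xs. olt (f xs) (g xs))"
  using dpred_ex[OF dpred_conj[OF assms(1)[unfolded od_iff] dpred_not[OF assms(2)[unfolded od_iff]]]]
  by (simp add: olt_interpolate)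

lemma od_butlast:
  assumes "od n f"
  shows "od (Suc n) (\<lambda>xs. f (butlast xs))"
  unfolding od_iff
  by (rule dpred_cong[OF od_take[OF assms, of "Suc n", unfolded od_iff]])
    (auto elim!: length_SucE simp: butlast_append)

text \<open>Discreteness describes the shift by one without multiplication: ord a + 1 < ord b holds
  iff some order lies strictly between.\<close>

lemma olt_pi_iff: "olt (\<pi> * a) b \<longleftrightarrow> (\<exists>z. olt a z \<and> olt z b)"
proof
  assume *: "olt (\<pi> * a) b"
  then have "a \<noteq> 0" by (auto simp: ordlt_def)
  then show "\<exists>z. olt a z \<and> olt z b" using * pi_olt by blast
next
  assume "\<exists>z. olt a z \<and> olt z b"
  then obtain z where z: "olt a z" "olt z b" by blast
  then have "\<not> olt z (\<pi> * a)" using olt_iff_not_olt_pi[of a z] olt_neqs(1) by blast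
  then show "olt (\<pi> * a) b" using le_olt_trans z(2) by blast
qed

lemma olt_div_pi_iff: "olt (a / \<pi>) b \<longleftrightarrow> a \<noteq> 0 \<and> \<not> olt b a"
  using olt_iff_not_olt_pi[of "a / \<pi>" b] by (cases "a = 0") (simp_all add: olt_neqs)

lemma od_pi_mult:
  assumes "od n f"
  shows "od n (\<lambda>xs. \<pi> * f xs)"
proof -
  \<comment> \<open>Position \<open>n\<close> carries the element compared with
    \<open>\<pi> * f xs\<close>; the last position carries the intermediate \<open>z\<close> of
    \<open>olt_pi_iff\<close>.\<close>
  have "dp (Suc (Suc n)) (\<lambda>xs. olt (f (take n xs)) (last xs))"
    using dpred_take_last[OF assms[unfolded od_iff], of "Suc n"] by simp
  moreover have "dp (Suc (Suc n)) (\<lambda>xs. olt (last xs) (xs ! n))"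
    using dp_olt[OF vd_imp_od[OF vd_last] vd_imp_od[OF vdef_nth]] by simp
  ultimately have *: "dp (Suc n) (\<lambda>xs. \<exists>z. olt (f (take n (xs @ [z]))) (last (xs @ [z])) \<and>
      olt (last (xs @ [z])) ((xs @ [z]) ! n))"
    by (intro dpred_ex dpred_conj)
  show ?thesis unfolding od_iff
    by (rule dpred_cong[OF *]) (auto elim!: length_SucE simp: olt_pi_iff nth_append)
qed

lemma od_div_pi:
  assumes "od n f"
  shows "od n (\<lambda>xs. f xs / \<pi>)"
proof -
  have "dp (Suc n) (\<lambda>xs. olt (f (butlast xs)) 0 \<and> \<not> olt (last xs) (f (butlast xs)))"
    by (intro dpred_conj dpred_not dp_olt od_butlast assms vd_imp_od vdef_const vd_last)
  then show ?thesis unfolding od_iff by (simp add: olt_div_pi_iff olt_neqs)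
qed

lemma od_pi_power_mult:
  assumes "od n f"
  shows "od n (\<lambda>xs. \<pi> ^ i * f xs)"
proof (induction i)
  case (Suc i)
  then show ?case using od_pi_mult[of n "\<lambda>xs. \<pi> ^ i * f xs"] by (simp add: mult.assoc)
qed (use assms in simp)

lemma od_div_pi_power:
  assumes "od n f"
  shows "od n (\<lambda>xs. f xs / \<pi> ^ i)"
proof (induction i)
  case (Suc i)
  then show ?case using od_div_pi[of n "\<lambda>xs. f xs / \<pi> ^ i"] by (simp add: mult.commute)
qed (use assms in simp)

text \<open>A cell has room for one bound on each side. Finitely many lower bounds amount to the
  pointwise largest order, and the defining condition of that function is a conjunction.\<close>

lemma od_lower_bounds:
  assumes "finite A" "A \<noteq> {}" "\<And>a. a \<in> A \<Longrightarrow> od n a"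
  shows "\<exists>f. od n f \<and> (\<forall>x s. olt (f x) s \<longleftrightarrow> (\<forall>a\<in>A. olt (a x) s))"
  using assms
proof (induction A rule: finite_ne_induct)
  case (singleton a)
  then show ?case by (intro exI[of _ a]) simp
next
  case (insert a A)
  then obtain f where f: "od n f" "\<And>x s. olt (f x) s \<longleftrightarrow> (\<forall>a\<in>A. olt (a x) s)" by auto
  define g where "g x = (if olt (a x) (f x) then f x else a x)" for x
  have *: "olt (g x) s \<longleftrightarrow> olt (a x) s \<and> olt (f x) s" for x s
    using olt_trans[of "a x" "f x" s] le_olt_trans[of "a x" "f x" s] by (auto simp: g_def)
  have "od n g" unfolding od_iff *
    using insert.prems[of a] f(1) by (intro dpred_conj) (simp_all add: od_iff)
  then show ?case using * f(2) by (intro exI[of _ g]) simp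
qed

text \<open>Dually, upper bounds amount to the pointwise smallest order, whose defining condition is
  a disjunction.\<close>

lemma od_upper_bounds:
  assumes "finite A" "A \<noteq> {}" "\<And>a. a \<in> A \<Longrightarrow> od n a"
  shows "\<exists>f. od n f \<and> (\<forall>x s. olt s (f x) \<longleftrightarrow> (\<forall>a\<in>A. olt s (a x)))"
  using assms
proof (induction A rule: finite_ne_induct)
  case (singleton a)
  then show ?case by (intro exI[of _ a]) simp
next
  case (insert a A)
  then obtain f where f: "od n f" "\<And>x s. olt s (f x) \<longleftrightarrow> (\<forall>a\<in>A. olt s (a x))" by auto
  define g where "g x = (if olt (a x) (f x) then a x else f x)" for x
  have *: "olt s (g x) \<longleftrightarrow> olt s (a x) \<and> olt s (f x)" for x s
    using olt_trans[of s "a x" "f x"] olt_le_trans[of s "f x" "a x"] by (auto simp: g_def)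
  have **: "olt (g x) s \<longleftrightarrow> olt (a x) s \<or> olt (f x) s" for x s
    using olt_trans[of "a x" "f x" s] le_olt_trans[of "a x" "f x" s] by (auto simp: g_def)
  have "od n g" unfolding od_iff **
    using insert.prems[of a] f(1) by (intro dpred_disj) (simp_all add: od_iff)
  then show ?case using * f(2) by (intro exI[of _ g]) simp
qed

lemma od_indicator:
  assumes "dp n P"
  shows "od n (\<lambda>xs. if P xs then 1 else 0)"
proof -
  have "dp (Suc n) (\<lambda>xs. P (take n xs) \<and> olt 1 (last xs))"
    by (intro dpred_conj dpred_take assms dp_olt vd_imp_od vdef_const vd_last) simp
  then show ?thesis unfolding od_iff
    by (rule dpred_cong) (auto elim!: length_SucE simp: olt_neqs)
qed

section \<open>Generalised cells and finite disjoint unions of cells\<close>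

definition ods :: "nat \<Rightarrow> ('k list \<Rightarrow> 'k) set" where
  "ods n = {f. od n f}"

definition in_fiber :: "('k list \<Rightarrow> bool) \<Rightarrow> ('k list \<Rightarrow> 'k) set \<Rightarrow> ('k list \<Rightarrow> 'k) set
    \<Rightarrow> 'k \<Rightarrow> nat \<Rightarrow> nat \<Rightarrow> 'k list \<Rightarrow> 'k \<Rightarrow> bool" where
  "in_fiber P A B l n m x s \<longleftrightarrow> P x \<and>
     (\<forall>a\<in>A. olt (a x) s) \<and> (\<forall>b\<in>B. olt s (b x)) \<and> s \<in> sQ l n m"

text \<open>A flexible form of cell: the base is any definable predicate, and the two flags and
  bounds become finite sets of bounds, empty for "no condition".\<close>

definition gcell :: "nat \<Rightarrow> ('k list \<Rightarrow> bool) \<Rightarrow> ('k list \<Rightarrow> 'k) set \<Rightarrow> ('k list \<Rightarrow> 'k) set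
    \<Rightarrow> ('k list \<Rightarrow> 'k) \<Rightarrow> 'k \<Rightarrow> nat \<Rightarrow> nat \<Rightarrow> 'k list set" where
  "gcell k P A B c l n m =
     {x @ [t] | x t. length x = k \<and> in_fiber P A B l n m x (t - c x)}"

lemma gcell_eq_cell:
  assumes P: "dp k P" and A: "finite A" "A \<subseteq> ods k" and B: "finite B" "B \<subseteq> ods k"
    and c: "qf_def_fun F R k c" and nm: "0 < n" "0 < m"
  shows "\<exists>C. cell_ok F R ods k C \<and> center C = c \<and> cell_set v \<pi> k C = gcell k P A B c l n m"
proof -
  have zero: "(\<lambda>_. 0) \<in> ods k" by (simp add: ods_def vd_imp_od vdef_const)
  \<comment> \<open>For an empty set of bounds the zero function is a placeholder, and the flag in
    \<open>C\<close> is switched off.\<close>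
  have "\<exists>f \<in> ods k. A \<noteq> {} \<longrightarrow> (\<forall>x s. olt (f x) s \<longleftrightarrow> (\<forall>a\<in>A. olt (a x) s))"
    using od_lower_bounds[OF A(1), of k] A(2) zero by (cases "A = {}") (auto simp: ods_def)
  then obtain f where f: "f \<in> ods k" "A \<noteq> {} \<Longrightarrow> \<forall>x s. olt (f x) s \<longleftrightarrow> (\<forall>a\<in>A. olt (a x) s)" by blast
  have "\<exists>g \<in> ods k. B \<noteq> {} \<longrightarrow> (\<forall>x s. olt s (g x) \<longleftrightarrow> (\<forall>b\<in>B. olt s (b x)))"
    using od_upper_bounds[OF B(1), of k] B(2) zero by (cases "B = {}") (auto simp: ods_def)
  then obtain g where g: "g \<in> ods k" "B \<noteq> {} \<Longrightarrow> \<forall>x s. olt s (g x) \<longleftrightarrow> (\<forall>b\<in>B. olt s (b x))" by blast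
  define h :: "'k list \<Rightarrow> 'k" where "h x = (if P x then 1 else 0)" for x
  have h: "h \<in> ods k" using od_indicator[OF P] by (simp add: ods_def h_def[abs_def])
  \<comment> \<open>The atom says ord h(x) < ord 0, that is, \<open>h x \<noteq> 0\<close>; this
    turns the definable base into a precell.\<close>
  define C where "C = Cell (BAtom (POrd h (\<lambda>_. 0) 0)) l n m f g (A \<noteq> {}) (B \<noteq> {}) c"
  have "cell_ok F R ods k C"
    using f(1) g(1) h zero c nm by (simp add: C_def)
  moreover have "cell_set v \<pi> k C = gcell k P A B c l n m"
    using f(2) g(2) unfolding gcell_def in_fiber_def C_def
    by (auto simp: precell_set_def ordlt_shift_def h_def)
  ultimately show ?thesis by (intro exI[of _ C]) (simp add: C_def)
qed

lemma dp_patom: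
  assumes "order_definable_coll v F R \<Delta>" "patom_ok F R \<Delta> k at"
  shows "dp k (\<lambda>x. patom_holds v \<pi> x at)"
proof (cases at)
  case (POrd a b l)
  then have ab: "od k a" "od k b"
    using assms by (auto simp: order_definable_coll_def)
  show ?thesis
  proof (cases l rule: int_cases2)
    case (nonneg i)
    then show ?thesis using dp_olt[OF ab(1) od_pi_power_mult[OF ab(2), of i]]
      by (simp add: POrd ordlt_shift_nonneg)
  next
    case (nonpos i)
    then show ?thesis using dp_olt[OF od_pi_power_mult[OF ab(1), of i] ab(2)]
      by (simp add: POrd ordlt_shift_neg)
  qed
next
  case (PQ f g l n m)
  then show ?thesis using assms(2) dp_sQ[OF qf_def_fun_imp_vdef qf_def_fun_imp_vdef]
    by simp
qed

lemma dp_beval: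
  assumes "order_definable_coll v F R \<Delta>" "\<forall>at \<in> set_bcomb D. patom_ok F R \<Delta> k at"
  shows "dp k (\<lambda>x. beval (patom_holds v \<pi> x) D)"
  using assms(2)
proof (induction D)
  case (BAtom at)
  then show ?case using dp_patom[OF assms(1)] by simp
next
  case (BNot D)
  then show ?case using dpred_not by simp
next
  case (BAnd D1 D2)
  then show ?case using dpred_conj by simp
next
  case (BOr D1 D2)
  then show ?case using dpred_disj by simp
qed

lemma cell_eq_gcell:
  assumes \<Delta>: "order_definable_coll v F R \<Delta>" and "cell_ok F R \<Delta> k C"
  obtains P A B l n m where "dp k P" "finite A" "A \<subseteq> ods k" "finite B" "B \<subseteq> ods k"
    "0 < n" "0 < m" "qf_def_fun F R k (center C)"
    "cell_set v \<pi> k C = gcell k P A B (center C) l n m"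
proof (cases C)
  case (Cell D l n m a b s t c)
  have ok: "\<forall>at \<in> set_bcomb D. patom_ok F R \<Delta> k at" "0 < n" "0 < m" "a \<in> \<Delta> k" "b \<in> \<Delta> k"
    "qf_def_fun F R k c"
    using assms(2) by (auto simp: Cell)
  have ab: "a \<in> ods k" "b \<in> ods k" using \<Delta> ok by (auto simp: order_definable_coll_def ods_def)
  show thesis
    \<comment> \<open>A bound whose flag is off turns into the empty set of bounds.\<close>
    by (rule that[of "\<lambda>x. beval (patom_holds v \<pi> x) D" "{f. s \<and> f = a}" "{f. t \<and> f = b}" n m l])
      (use ok ab dp_beval[OF \<Delta>] in \<open>auto simp: Cell gcell_def in_fiber_def precell_set_def\<close>)
qed

text \<open>Lists with \<open>sorted_wrt\<close> express disjointness by position, as in the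
  theorem, so that empty cells may repeat; comparing only earlier with later entries suits
  concatenation.\<close>

definition decomposable :: "nat \<Rightarrow> ('k list \<Rightarrow> 'k) set \<Rightarrow> 'k list set \<Rightarrow> bool" where
  "decomposable k Z S \<longleftrightarrow> (\<exists>cs. (\<forall>C \<in> set cs. cell_ok F R ods k C \<and> center C \<in> Z) \<and>
     sorted_wrt (\<lambda>C C'. cell_set v \<pi> k C \<inter> cell_set v \<pi> k C' = {}) cs \<and>
     (\<Union>C \<in> set cs. cell_set v \<pi> k C) = S)"

lemma decomposable_gcell:
  assumes "dp k P" "finite A" "A \<subseteq> ods k" "finite B" "B \<subseteq> ods k"
    "qf_def_fun F R k c" "0 < n" "0 < m" "c \<in> Z"
  shows "decomposable k Z (gcell k P A B c l n m)"
proof -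
  obtain C where "cell_ok F R ods k C \<and> center C = c \<and> cell_set v \<pi> k C = gcell k P A B c l n m"
    using gcell_eq_cell[OF assms(1-8)] ..
  then show ?thesis unfolding decomposable_def using assms(9) by (intro exI[of _ "[C]"]) simp
qed

lemma decomposable_empty: "decomposable k Z {}"
  unfolding decomposable_def by (intro exI[of _ "[]"]) simp

lemma decomposable_Un:
  assumes "decomposable k Z S" "decomposable k Z T" "S \<inter> T = {}"
  shows "decomposable k Z (S \<union> T)"
proof -
  obtain cs where cs: "\<forall>C \<in> set cs. cell_ok F R ods k C \<and> center C \<in> Z"
    "sorted_wrt (\<lambda>C C'. cell_set v \<pi> k C \<inter> cell_set v \<pi> k C' = {}) cs"
    "(\<Union>C \<in> set cs. cell_set v \<pi> k C) = S"
    using assms(1) unfolding decomposable_def by blast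
  obtain ds where ds: "\<forall>C \<in> set ds. cell_ok F R ods k C \<and> center C \<in> Z"
    "sorted_wrt (\<lambda>C C'. cell_set v \<pi> k C \<inter> cell_set v \<pi> k C' = {}) ds"
    "(\<Union>C \<in> set ds. cell_set v \<pi> k C) = T"
    using assms(2) unfolding decomposable_def by blast
  have "cell_set v \<pi> k C \<inter> cell_set v \<pi> k C' = {}" if "C \<in> set cs" "C' \<in> set ds" for C C'
    using that cs(3) ds(3) assms(3) by blast
  then show ?thesis unfolding decomposable_def using cs ds
    by (intro exI[of _ "cs @ ds"]) (auto simp: sorted_wrt_append)
qed

lemma decomposable_UN:
  assumes "finite I" "\<And>i. i \<in> I \<Longrightarrow> decomposable k Z (S i)"
    "\<And>i j. i \<in> I \<Longrightarrow> j \<in> I \<Longrightarrow> i \<noteq> j \<Longrightarrow> S i \<inter> S j = {}"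
  shows "decomposable k Z (\<Union>i\<in>I. S i)"
  using assms
proof (induction I)
  case empty
  then show ?case using decomposable_empty by simp
next
  case (insert i I)
  have "decomposable k Z (S i \<union> (\<Union>i\<in>I. S i))"
  proof (rule decomposable_Un)
    show "decomposable k Z (\<Union>i\<in>I. S i)" using insert by auto
    show "S i \<inter> (\<Union>i\<in>I. S i) = {}" using insert.hyps(2) insert.prems(2)[of i] by fastforce
  qed (use insert in auto)
  then show ?case by simp
qed

text \<open>The fibre condition sees \<open>s\<close> only through its order and its coset. This is
  how a condition on t - c2 is traded for one on c1 - c2, on t - c1, or at another point of a
  ball.\<close>

lemma in_fiber_cong:
  assumes "s \<noteq> 0" "s' \<noteq> 0" "v s' = v s" "s' \<in> sQ l n m \<longleftrightarrow> s \<in> sQ l n m"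
  shows "in_fiber P A B l n m x s' \<longleftrightarrow> in_fiber P A B l n m x s"
proof -
  have "olt s' b \<longleftrightarrow> olt s b" "olt b s' \<longleftrightarrow> olt b s" for b
    using olt_cong[of s' s b] assms(1,2,3) by auto
  then show ?thesis using assms(4) by (simp add: in_fiber_def)
qed

section \<open>The intersection of two cells, region by region\<close>

lemma mem_gcell_iff:
  "x @ [t] \<in> gcell k P A B c l n m \<longleftrightarrow> length x = k \<and> in_fiber P A B l n m x (t - c x)"
  by (auto simp: gcell_def)

lemma mem_gcellE:
  assumes "y \<in> gcell k P A B c l n m"
  obtains x t where "y = x @ [t]" "length x = k" "in_fiber P A B l n m x (t - c x)"
  using assms by (auto simp: gcell_def)

lemma dp_butlast: "dp k P \<Longrightarrow> dp (Suc k) (\<lambda>xs. P (butlast xs))"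
  by (rule dpred_cong[OF dpred_take[of F R k P "Suc k"]]) (auto elim!: length_SucE)

lemma dp_in_fiber:
  assumes "dp k P" "finite A" "A \<subseteq> ods k" "finite B" "B \<subseteq> ods k" "0 < n" "0 < m"
    and c: "vd k c"
  shows "dp (Suc k) (\<lambda>xs. in_fiber P A B l n m (butlast xs) (last xs - c (butlast xs)))"
  unfolding in_fiber_def
  using assms(3,5)
  by (intro dpred_conj dpred_ball assms dp_butlast dp_olt od_butlast od_diff dp_sQ vd_last
      vd_butlast) (auto simp: ods_def)

text \<open>A zero coefficient forces t = c1(x). The intersection is the graph of c1 over a
  definable set, again a cell with coefficient 0.\<close>

lemma decomposable_zero:
  assumes 1: "dp k P1" "finite A1" "A1 \<subseteq> ods k" "finite B1" "B1 \<subseteq> ods k" "0 < n1" "0 < m1"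
    and 2: "dp k P2" "finite A2" "A2 \<subseteq> ods k" "finite B2" "B2 \<subseteq> ods k" "0 < n2" "0 < m2"
    and c: "qf_def_fun F R k c1" "qf_def_fun F R k c2" and Z: "c1 \<in> Z"
  shows "decomposable k Z (gcell k P1 A1 B1 c1 0 n1 m1 \<inter> gcell k P2 A2 B2 c2 l n2 m2)"
proof -
  define P where "P x \<longleftrightarrow> in_fiber P1 A1 B1 0 n1 m1 x (c1 x - c1 x) \<and>
    in_fiber P2 A2 B2 l n2 m2 x (c1 x - c2 x)" for x
  have vd: "vd k c1" "vd k c2" using c qf_def_fun_imp_vdef by auto
  have "dp k (\<lambda>x. in_fiber P1 A1 B1 0 n1 m1 x (c1 x - c1 x))"
    using dpred_subst[OF dp_in_fiber[OF 1 vd(1)] vd(1)] by simp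
  moreover have "dp k (\<lambda>x. in_fiber P2 A2 B2 l n2 m2 x (c1 x - c2 x))"
    using dpred_subst[OF dp_in_fiber[OF 2 vd(2)] vd(1)] by simp
  ultimately have "dp k P" unfolding P_def by (rule dpred_conj)
  then have "decomposable k Z (gcell k P {} {} c1 0 1 1)"
    by (intro decomposable_gcell) (simp_all add: c Z)
  moreover have "gcell k P1 A1 B1 c1 0 n1 m1 \<inter> gcell k P2 A2 B2 c2 l n2 m2 = gcell k P {} {} c1 0 1 1"
    using sQ_zero[OF \<open>0 < m1\<close>, of _ n1] sQ_zero[of 1 _ 1]
    by (auto simp: gcell_def in_fiber_def P_def)
  ultimately show ?thesis by simp
qed

text \<open>By \<open>near_close\<close> the second cell's condition can be tested at c1 - c2 in
  place of t - c2. It then concerns \<open>x\<close> alone and moves into the base, while nearness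
  becomes one more lower bound.\<close>

lemma decomposable_near:
  assumes 1: "dp k P1" "finite A1" "A1 \<subseteq> ods k" "finite B1" "B1 \<subseteq> ods k" "0 < n1" "0 < m1"
    and 2: "dp k P2" "finite A2" "A2 \<subseteq> ods k" "finite B2" "B2 \<subseteq> ods k" "0 < n2" "0 < m2"
    and c: "qf_def_fun F R k c1" "qf_def_fun F R k c2" and Z: "c1 \<in> Z" and L: "m2 \<le> L"
  shows "decomposable k Z {x @ [t] | x t. length x = k \<and> in_fiber P1 A1 B1 l1 n1 m1 x (t - c1 x) \<and>
    in_fiber P2 A2 B2 l2 n2 m2 x (t - c2 x) \<and> olt (\<pi> ^ L * (c1 x - c2 x)) (t - c1 x)}"
    (is "decomposable k Z ?S")
proof -
  define P where "P x \<longleftrightarrow> P1 x \<and> in_fiber P2 A2 B2 l2 n2 m2 x (c1 x - c2 x)" for x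
  define a where "a x = \<pi> ^ L * (c1 x - c2 x)" for x
  have vd: "vd k c1" "vd k c2" using c qf_def_fun_imp_vdef by auto
  have "dp k (\<lambda>x. in_fiber P2 A2 B2 l2 n2 m2 x (c1 x - c2 x))"
    using dpred_subst[OF dp_in_fiber[OF 2 vd(2)] vd(1)] by simp
  then have "dp k P" unfolding P_def by (rule dpred_conj[OF 1(1)])
  moreover have "a \<in> ods k"
    unfolding ods_def a_def[abs_def] using od_pi_power_mult[OF od_diff[OF vd]] by simp
  ultimately have "decomposable k Z (gcell k P (insert a A1) B1 c1 l1 n1 m1)"
    using 1 c Z by (intro decomposable_gcell) auto
  moreover have "?S = gcell k P (insert a A1) B1 c1 l1 n1 m1"
  proof -
    have *: "in_fiber P2 A2 B2 l2 n2 m2 x (t - c2 x) \<longleftrightarrow> in_fiber P2 A2 B2 l2 n2 m2 x (c1 x - c2 x)"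
      if "olt (\<pi> ^ L * (c1 x - c2 x)) (t - c1 x)" for x t
    proof -
      from near_close[OF that L \<open>0 < m2\<close>] show ?thesis by (intro in_fiber_cong) auto
    qed
    have "in_fiber P1 A1 B1 l1 n1 m1 x (t - c1 x) \<and> in_fiber P2 A2 B2 l2 n2 m2 x (t - c2 x) \<and>
        olt (\<pi> ^ L * (c1 x - c2 x)) (t - c1 x) \<longleftrightarrow>
        in_fiber P (insert a A1) B1 l1 n1 m1 x (t - c1 x)" for x t
    proof (cases "olt (\<pi> ^ L * (c1 x - c2 x)) (t - c1 x)")
      case True
      then have "olt (a x) (t - c1 x)" by (simp add: a_def)
      then show ?thesis using True *[OF True] unfolding in_fiber_def[of P] in_fiber_def[of P1] P_def
        by auto
    next
      case False
      then show ?thesis by (simp add: in_fiber_def a_def)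
    qed
    then show ?thesis unfolding gcell_def by simp
  qed
  ultimately show ?thesis by simp
qed

lemma gcell_disjoint:
  assumes "sQ l n m \<inter> sQ l' n m = {}"
  shows "gcell k P A B c l n m \<inter> gcell k P' A' B' c l' n m = {}"
  using assms by (auto simp: gcell_def in_fiber_def)

lemma decomposable_far:
  assumes 1: "dp k P1" "finite A1" "A1 \<subseteq> ods k" "finite B1" "B1 \<subseteq> ods k" "0 < n1" "0 < m1"
    and 2: "dp k P2" "finite A2" "A2 \<subseteq> ods k" "finite B2" "B2 \<subseteq> ods k" "0 < n2" "0 < m2"
    and c: "qf_def_fun F R k c1" "qf_def_fun F R k c2" and Z: "c1 \<in> Z" and L: "m2 \<le> L"
  shows "decomposable k Z {x @ [t] | x t. length x = k \<and> in_fiber P1 A1 B1 l1 n1 m1 x (t - c1 x) \<and>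
    in_fiber P2 A2 B2 l2 n2 m2 x (t - c2 x) \<and> olt (t - c1 x) ((c1 x - c2 x) / \<pi> ^ L)}"
    (is "decomposable k Z ?S")
proof -
  define P where "P x \<longleftrightarrow> P1 x \<and> P2 x" for x
  define b where "b x = (c1 x - c2 x) / \<pi> ^ L" for x
  \<comment> \<open>\<open>N\<close> is a common multiple of the two exponents and \<open>M\<close>
    dominates both precisions, so \<open>Q N M\<close> is contained in both groups.\<close>
  define N M where "N = n1 * n2" and "M = m1 + m2"
  have NM: "0 < N" "0 < M" using \<open>0 < n1\<close> \<open>0 < n2\<close> \<open>0 < m1\<close> by (simp_all add: N_def M_def)
  have vd: "vd k c1" "vd k c2" using c qf_def_fun_imp_vdef by auto
  obtain \<Lambda> where \<Lambda>_fin: "finite \<Lambda>" "0 \<notin> \<Lambda>" "\<forall>x. x \<noteq> 0 \<longrightarrow> (\<exists>l \<in> \<Lambda>. x \<in> sQ l N M)"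
    "\<forall>l \<in> \<Lambda>. \<forall>l' \<in> \<Lambda>. l \<noteq> l' \<longrightarrow> sQ l N M \<inter> sQ l' N M = {}"
    by (rule coset_representatives[OF NM(2,1)])
  note \<Lambda> = \<Lambda>_fin(1,2) \<Lambda>_fin(3,4)[rule_format]
  \<comment> \<open>The cosets contained in both given ones. They fill the intersection, since by
    \<open>sQ_subset\<close> a coset of \<open>Q N M\<close> with a point in both lies in
    both.\<close>
  define I where "I = {l \<in> \<Lambda>. sQ l N M \<subseteq> sQ l1 n1 m1 \<and> sQ l N M \<subseteq> sQ l2 n2 m2}"
  define G where "G l = gcell k P (A1 \<union> A2) (insert b (B1 \<union> B2)) c1 l N M" for l
  have "dp k P" unfolding P_def by (rule dpred_conj[OF 1(1) 2(1)])
  moreover have "b \<in> ods k"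
    unfolding ods_def b_def[abs_def] using od_div_pi_power[OF od_diff[OF vd]] by simp
  ultimately have "decomposable k Z (G l)" for l
    unfolding G_def using 1 2 c Z NM by (intro decomposable_gcell) auto
  then have "decomposable k Z (\<Union>l\<in>I. G l)"
    using \<Lambda>(1) gcell_disjoint[OF \<Lambda>(4)] unfolding G_def I_def by (intro decomposable_UN) auto
  moreover have "?S = (\<Union>l\<in>I. G l)"
  proof -
    have "in_fiber P1 A1 B1 l1 n1 m1 x (t - c1 x) \<and> in_fiber P2 A2 B2 l2 n2 m2 x (t - c2 x) \<and>
        olt (t - c1 x) ((c1 x - c2 x) / \<pi> ^ L) \<longleftrightarrow>
        (\<exists>l\<in>I. in_fiber P (A1 \<union> A2) (insert b (B1 \<union> B2)) l N M x (t - c1 x))" for x t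
    proof (cases "olt (t - c1 x) ((c1 x - c2 x) / \<pi> ^ L)")
      case True
      then have b: "olt (t - c1 x) (b x)" by (simp add: b_def)
      note far = far_close[OF True L \<open>0 < m2\<close>]
      then have *: "in_fiber P2 A2 B2 l2 n2 m2 x (t - c2 x) \<longleftrightarrow> in_fiber P2 A2 B2 l2 n2 m2 x (t - c1 x)"
        by (intro in_fiber_cong) auto
      have **: "t - c1 x \<in> sQ l1 n1 m1 \<and> t - c1 x \<in> sQ l2 n2 m2 \<longleftrightarrow> (\<exists>l\<in>I. t - c1 x \<in> sQ l N M)"
      proof
        assume s: "t - c1 x \<in> sQ l1 n1 m1 \<and> t - c1 x \<in> sQ l2 n2 m2"
        obtain l where l: "l \<in> \<Lambda>" "t - c1 x \<in> sQ l N M" using \<Lambda>(3)[OF far(1)] by blast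
        then have "l \<noteq> 0" using \<Lambda>(2) by auto
        have "sQ l N M \<subseteq> sQ l1 n1 m1" "sQ l N M \<subseteq> sQ l2 n2 m2"
          using sQ_subset[OF \<open>0 < m1\<close> _ _ \<open>l \<noteq> 0\<close> l(2)] sQ_subset[OF \<open>0 < m2\<close> _ _ \<open>l \<noteq> 0\<close> l(2)] s
          by (auto simp: N_def M_def)
        then show "\<exists>l\<in>I. t - c1 x \<in> sQ l N M" using l by (auto simp: I_def)
      qed (auto simp: I_def)
      show ?thesis unfolding * using ** True b by (auto simp: in_fiber_def P_def)
    next
      case False
      then show ?thesis by (simp add: in_fiber_def b_def)
    qed
    then show ?thesis unfolding G_def gcell_def by auto
  qed
  ultimately show ?thesis by simp
qed

text \<open>Excluding a neighbourhood of c2 as well bounds the order of t - c2 from above. A ball of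
  fixed relative size around t - c1 is then small relative to t - c2 too.\<close>

lemma decomposable_middle:
  assumes 1: "dp k P1" "finite A1" "A1 \<subseteq> ods k" "finite B1" "B1 \<subseteq> ods k" "0 < n1" "0 < m1"
    and 2: "dp k P2" "finite A2" "A2 \<subseteq> ods k" "finite B2" "B2 \<subseteq> ods k" "0 < n2" "0 < m2"
    and c: "qf_def_fun F R k c1" "qf_def_fun F R k c2" and Z: "c1 \<in> Z"
    and L: "m1 \<le> L" and l: "l1 \<noteq> 0" "l2 \<noteq> 0"
  shows "decomposable k Z {x @ [t] | x t. length x = k \<and> in_fiber P1 A1 B1 l1 n1 m1 x (t - c1 x) \<and>
    in_fiber P2 A2 B2 l2 n2 m2 x (t - c2 x) \<and> \<not> olt (t - c1 x) ((c1 x - c2 x) / \<pi> ^ L) \<and>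
    \<not> olt (\<pi> ^ L * (c1 x - c2 x)) (t - c1 x) \<and> \<not> olt (\<pi> ^ L * (c1 x - c2 x)) (t - c2 x)}"
    (is "decomposable k Z ?S")
proof -
  define d where "d x = c1 x - c2 x" for x
  define e where "e x = d x / \<pi> ^ L" for x
  \<comment> \<open>\<open>M\<close> is the precision that \<open>middle_close\<close> requires for
    the second cell; \<open>m1 \<le> L\<close> makes it sufficient for the first cell too.\<close>
  define N M where "N = n1 * n2" and "M = 2 * L + m2"
  have NM: "0 < N" "0 < M" using \<open>0 < n1\<close> \<open>0 < n2\<close> \<open>0 < m2\<close> by (simp_all add: N_def M_def)
  have vd: "vd k c1" "vd k c2" using c qf_def_fun_imp_vdef by auto
  obtain \<Lambda> where \<Lambda>_fin: "finite \<Lambda>" "0 \<notin> \<Lambda>" "\<forall>x. x \<noteq> 0 \<longrightarrow> (\<exists>l \<in> \<Lambda>. x \<in> sQ l N M)"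
    "\<forall>l \<in> \<Lambda>. \<forall>l' \<in> \<Lambda>. l \<noteq> l' \<longrightarrow> sQ l N M \<inter> sQ l' N M = {}"
    by (rule coset_representatives[OF NM(2,1)])
  note \<Lambda> = \<Lambda>_fin(1,2) \<Lambda>_fin(3,4)[rule_format]
  \<comment> \<open>Bounds one step on either side of \<open>\<pi> ^ i * e x\<close>, which by
    \<open>val_eq_iff\<close> fix the order of \<open>t - c1 x\<close>.\<close>
  define A B where "A i = {\<lambda>x. \<pi> ^ i * e x / \<pi>}" and "B i = {\<lambda>x. \<pi> * (\<pi> ^ i * e x)}" for i
  define W where "W x t \<longleftrightarrow> in_fiber P1 A1 B1 l1 n1 m1 x (t - c1 x) \<and>
    in_fiber P2 A2 B2 l2 n2 m2 x (t - c2 x) \<and> \<not> olt (\<pi> ^ L * d x) (t - c2 x)" for x t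
  define V where "V i l x t \<longleftrightarrow> in_fiber (\<lambda>_. True) (A i) (B i) l N M x (t - c1 x)" for i l x t
  \<comment> \<open>One point of \<open>V i l x\<close> satisfying \<open>W\<close> suffices, since
    the others then satisfy it too; the existential form makes the condition definable.\<close>
  define P where "P i l x \<longleftrightarrow> (\<exists>t. W x t \<and> V i l x t)" for i l x
  define G where "G = (\<lambda>(i, l). gcell k (P i l) (A i) (B i) c1 l N M)"
  have V: "V i l x t \<longleftrightarrow> e x \<noteq> 0 \<and> t - c1 x \<noteq> 0 \<and> v (t - c1 x) = v (\<pi> ^ i * e x) \<and> t - c1 x \<in> sQ l N M"
    for i l x t
    using val_eq_iff[of "\<pi> ^ i * e x" "t - c1 x"] by (auto simp: V_def in_fiber_def A_def B_def)
  have mem_G: "x @ [t] \<in> G (i, l) \<longleftrightarrow> length x = k \<and> P i l x \<and> V i l x t" for x t i l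
    by (simp add: G_def mem_gcell_iff V_def in_fiber_def)
  have AB: "A i \<subseteq> ods k" "B i \<subseteq> ods k" for i
    using od_div_pi[OF od_pi_power_mult[OF od_div_pi_power[OF od_diff[OF vd]]]]
      od_pi_mult[OF od_pi_power_mult[OF od_div_pi_power[OF od_diff[OF vd]]]]
    by (auto simp: A_def B_def ods_def e_def d_def)
  have od: "od k (\<lambda>x. \<pi> ^ L * d x)"
    unfolding d_def by (rule od_pi_power_mult[OF od_diff[OF vd]])
  have dpV: "dp (Suc k) (\<lambda>xs. V i l (butlast xs) (last xs))" for i l
    unfolding V_def using AB NM vd
    by (intro dp_in_fiber dpred_const) (auto simp: A_def B_def)
  have "dp (Suc k) (\<lambda>xs. W (butlast xs) (last xs))"
    unfolding W_def
    by (intro dpred_conj dpred_not dp_in_fiber 1 2 vd dp_olt od_butlast od od_diff vd_last vd_butlast)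
  from dpred_ex[OF dpred_conj[OF this dpV]] have "dp k (P i l)" for i l
    unfolding P_def by simp
  then have "decomposable k Z (G (i, l))" for i l
    unfolding G_def using AB c Z NM by (auto intro!: decomposable_gcell simp: A_def B_def)
  moreover have "G p \<inter> G p' = {}" if p: "p \<in> {..2 * L} \<times> \<Lambda>" "p' \<in> {..2 * L} \<times> \<Lambda>" "p \<noteq> p'" for p p'
  proof (rule ccontr)
    obtain i l i' l' where il: "p = (i, l)" "p' = (i', l')" by (cases p; cases p')
    assume "G p \<inter> G p' \<noteq> {}"
    then obtain y where y: "y \<in> G (i, l)" "y \<in> G (i', l')" using il by blast
    then obtain x t where "y = x @ [t]" unfolding G_def by (auto elim: mem_gcellE)
    then have Vs: "V i l x t" "V i' l' x t" using y mem_G by auto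
    then have "l = l'" using \<Lambda>(4)[of l l'] p(1,2) by (auto simp: il V)
    then have "i \<noteq> i'" using p(3) by (simp add: il)
    moreover have "e x \<noteq> 0" "v (\<pi> ^ i * e x) = v (\<pi> ^ i' * e x)" using Vs by (auto simp: V)
    ultimately show False
      using pi_power_less[of i i' "e x"] pi_power_less[of i' i "e x"]
      by (cases "i < i'") (auto simp: ordlt_def)
  qed
  ultimately have dec: "decomposable k Z (\<Union>p\<in>{..2 * L} \<times> \<Lambda>. G p)"
    using \<Lambda>(1) by (intro decomposable_UN) auto
  \<comment> \<open>\<open>e\<close> marks the lower end of the middle region; the upper end, ord d
    + L, is \<open>2 * L\<close> steps above it.\<close>
  have e2: "\<pi> ^ (2 * L) * e x = \<pi> ^ L * d x" for x
    by (simp add: e_def mult_2 power_add)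
  have "?S = {x @ [t] | x t. length x = k \<and> W x t \<and> \<not> olt (t - c1 x) (e x) \<and>
      \<not> olt (\<pi> ^ L * d x) (t - c1 x)}"
    unfolding W_def e_def d_def by blast
  also have "\<dots> = (\<Union>p\<in>{..2 * L} \<times> \<Lambda>. G p)"
  proof (rule subset_antisym; rule subsetI)
    fix y
    assume "y \<in> {x @ [t] | x t. length x = k \<and> W x t \<and> \<not> olt (t - c1 x) (e x) \<and>
      \<not> olt (\<pi> ^ L * d x) (t - c1 x)}"
    then obtain x t where y: "y = x @ [t]" "length x = k" "W x t" "\<not> olt (t - c1 x) (e x)"
      "\<not> olt (\<pi> ^ (2 * L) * e x) (t - c1 x)" unfolding e2 by blast
    have s: "t - c1 x \<noteq> 0" using y(3) sQ_nz[OF \<open>0 < m1\<close> l(1)] unfolding W_def in_fiber_def by blast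
    obtain i where i: "i \<le> 2 * L" "v (t - c1 x) = v (\<pi> ^ i * e x)"
      using middle_val(2)[OF s y(4,5)] by blast
    obtain l where l: "l \<in> \<Lambda>" "t - c1 x \<in> sQ l N M" using \<Lambda>(3)[OF s] by blast
    have "V i l x t" unfolding V using middle_val(1)[OF s y(4,5)] s i(2) l(2) by simp
    then have "y \<in> G (i, l)" using y(1-3) mem_G P_def by blast
    then show "y \<in> (\<Union>p\<in>{..2 * L} \<times> \<Lambda>. G p)" using i(1) l(1) by blast
  next
    fix y assume "y \<in> (\<Union>p\<in>{..2 * L} \<times> \<Lambda>. G p)"
    then obtain i l where il: "i \<le> 2 * L" "l \<in> \<Lambda>" "y \<in> G (i, l)" by blast
    then obtain x t where y: "y = x @ [t]" unfolding G_def by (auto elim: mem_gcellE)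
    then have x: "length x = k" "P i l x" "V i l x t" using il(3) mem_G by auto
    \<comment> \<open>The witness \<open>t0\<close> lies in the same ball as \<open>t\<close>, and
      \<open>W\<close> is now carried over from \<open>t0\<close> to \<open>t\<close>.\<close>
    then obtain t0 where t0: "W x t0" "V i l x t0" unfolding P_def by blast
    have l0: "l \<noteq> 0" using il(2) \<Lambda>(2) by auto
    define s s0 where "s = t - c1 x" and "s0 = t0 - c1 x"
    have sd: "t - c2 x = s + d x" "t0 - c2 x = s0 + d x" by (simp_all add: s_def s0_def d_def)
    have V': "e x \<noteq> 0" "s \<noteq> 0" "s0 \<noteq> 0" "v s = v (\<pi> ^ i * e x)" "v s0 = v (\<pi> ^ i * e x)"
      "s \<in> sQ l N M" "s0 \<in> sQ l N M"
      using x(3) t0(2) unfolding V s_def s0_def by auto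
    have vs: "v s = v s0" using V' by simp
    have "d x \<noteq> 0" using V'(1) by (auto simp: e_def)
    have W0: "in_fiber P1 A1 B1 l1 n1 m1 x s0" "in_fiber P2 A2 B2 l2 n2 m2 x (s0 + d x)"
      "\<not> olt (\<pi> ^ L * d x) (s0 + d x)"
      using t0(1) unfolding W_def sd s0_def[symmetric] by auto
    have nz: "s0 + d x \<noteq> 0" using W0(2) sQ_nz[OF \<open>0 < m2\<close> \<open>l2 \<noteq> 0\<close>] unfolding in_fiber_def by blast
    note close = middle_close[OF l0 \<open>0 < m2\<close> V'(7,6)[unfolded M_def] V'(5)[unfolded e_def] vs
        \<open>d x \<noteq> 0\<close> nz W0(3)]
    have "s \<in> sQ l1 n1 m1 \<longleftrightarrow> s0 \<in> sQ l1 n1 m1"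
    proof -
      have "m1 \<le> M" "n1 dvd N" using L by (simp_all add: M_def N_def)
      note sub = sQ_subset[OF \<open>0 < m1\<close> this l0]
      from sub[OF V'(6), of l1] sub[OF V'(7), of l1] V'(6,7) show ?thesis by blast
    qed
    then have "in_fiber P1 A1 B1 l1 n1 m1 x s"
      using in_fiber_cong[OF V'(3,2) vs] W0(1) by blast
    moreover have "in_fiber P2 A2 B2 l2 n2 m2 x (s + d x)"
      using in_fiber_cong[OF nz close(1,2,3)] W0(2) by blast
    moreover have "\<not> olt (\<pi> ^ L * d x) (s + d x)"
      using olt_cong(2)[OF nz close(1) close(2)[symmetric]] W0(3) by blast
    ultimately have "W x t" unfolding W_def sd s_def[symmetric] by simp
    moreover have "\<not> olt s (e x)"
      using pi_power_le[of 0 i "e x"] olt_cong(1)[OF V'(2) _ V'(4), of "e x"] V'(1) by simp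
    moreover have "\<not> olt (\<pi> ^ L * d x) s"
      using pi_power_le[OF il(1), of "e x"] olt_cong(2)[OF V'(2) _ V'(4), of "\<pi> ^ L * d x"] V'(1)
      unfolding e2 by simp
    ultimately show "y \<in> {x @ [t] | x t. length x = k \<and> W x t \<and> \<not> olt (t - c1 x) (e x) \<and>
      \<not> olt (\<pi> ^ L * d x) (t - c1 x)}"
      using y x(1) unfolding s_def by blast
  qed
  finally show ?thesis using dec by simp
qed

section \<open>Assembling the regions\<close>

lemma decomposable_Int:
  assumes 1: "dp k P1" "finite A1" "A1 \<subseteq> ods k" "finite B1" "B1 \<subseteq> ods k" "0 < n1" "0 < m1"
    and 2: "dp k P2" "finite A2" "A2 \<subseteq> ods k" "finite B2" "B2 \<subseteq> ods k" "0 < n2" "0 < m2"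
    and c: "qf_def_fun F R k c1" "qf_def_fun F R k c2" and Z: "c1 \<in> Z" "c2 \<in> Z"
  shows "decomposable k Z (gcell k P1 A1 B1 c1 l1 n1 m1 \<inter> gcell k P2 A2 B2 c2 l2 n2 m2)"
    (is "decomposable k Z (?C1 \<inter> ?C2)")
proof -
  consider "l1 = 0" | "l2 = 0" | "l1 \<noteq> 0" "l2 \<noteq> 0" by blast
  then show ?thesis
  proof cases
    assume "l1 = 0"
    then show ?thesis using decomposable_zero[OF 1 2 c Z(1)] by simp
  next
    assume "l2 = 0"
    then show ?thesis using decomposable_zero[OF 2 1 c(2,1) Z(2)] by (simp add: Int_commute)
  next
    assume l: "l1 \<noteq> 0" "l2 \<noteq> 0"
    define L where "L = m1 + m2"
    have L: "m1 \<le> L" "m2 \<le> L" by (simp_all add: L_def)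
    define W where "W x t \<longleftrightarrow> length x = k \<and> in_fiber P1 A1 B1 l1 n1 m1 x (t - c1 x) \<and>
      in_fiber P2 A2 B2 l2 n2 m2 x (t - c2 x)" for x t
    \<comment> \<open>If the centers agree at \<open>x\<close>, the order of their difference is
      infinite: both near regions are empty there, and the far region is all of
      \<open>t \<noteq> c1 x\<close>.\<close>
    define near1 near2 far where "near1 x t \<longleftrightarrow> olt (\<pi> ^ L * (c1 x - c2 x)) (t - c1 x)"
      and "near2 x t \<longleftrightarrow> olt (\<pi> ^ L * (c1 x - c2 x)) (t - c2 x)"
      and "far x t \<longleftrightarrow> olt (t - c1 x) ((c1 x - c2 x) / \<pi> ^ L)" for x t
    define S where "S T = {x @ [t] | x t. W x t \<and> T x t}" for T :: "'k list \<Rightarrow> 'k \<Rightarrow> bool"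
    have part1: "decomposable k Z (S near1)"
      using decomposable_near[OF 1 2 c Z(1) L(2)] by (simp add: S_def W_def near1_def)
    have part2: "decomposable k Z (S near2)"
    proof -
      \<comment> \<open>Exchanging the two cells changes only the sign of the difference of the
        centers, which leaves its order unchanged.\<close>
      have *: "olt (\<pi> ^ L * (c2 x - c1 x)) s \<longleftrightarrow> olt (\<pi> ^ L * (c1 x - c2 x)) s" for x s
        using olt_minus(1)[of "\<pi> ^ L * (c1 x - c2 x)" s] by (simp only: minus_mult_right minus_diff_eq)
      have "S near2 = {x @ [t] | x t. length x = k \<and> in_fiber P2 A2 B2 l2 n2 m2 x (t - c2 x) \<and>
          in_fiber P1 A1 B1 l1 n1 m1 x (t - c1 x) \<and> olt (\<pi> ^ L * (c2 x - c1 x)) (t - c2 x)}"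
        unfolding S_def W_def near2_def * by blast
      then show ?thesis using decomposable_near[OF 2 1 c(2,1) Z(2) L(1)] by simp
    qed
    have part3: "decomposable k Z (S far)"
      using decomposable_far[OF 1 2 c Z(1) L(2)] by (simp add: S_def W_def far_def)
    have part4: "decomposable k Z (S (\<lambda>x t. \<not> far x t \<and> \<not> near1 x t \<and> \<not> near2 x t))"
      using decomposable_middle[OF 1 2 c Z(1) L(1) l]
      by (simp add: S_def W_def far_def near1_def near2_def)
    note parts = part1 part2 part3 part4
    have S_disj: "S T \<inter> S T' = {}" if "\<And>x t. \<not> (T x t \<and> T' x t)" for T T'
      using that unfolding S_def by auto
    \<comment> \<open>Near c1 the order of t - c2 is that of the difference d of the centers, and in
      the far region it is that of t - c1; neither exceeds ord d + L.\<close>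
    have excl: "\<not> (near1 x t \<and> near2 x t)" "\<not> (far x t \<and> near1 x t)" "\<not> (far x t \<and> near2 x t)" for x t
    proof -
      have sd: "t - c2 x = (t - c1 x) + (c1 x - c2 x)" by simp
      show "\<not> (far x t \<and> near1 x t)" using far_not_near unfolding far_def near1_def by blast
      show "\<not> (near1 x t \<and> near2 x t)"
      proof
        assume *: "near1 x t \<and> near2 x t"
        note close = near_close(1-3)[OF conjunct1[OF *, unfolded near1_def] L(2) \<open>0 < m2\<close>]
        have "\<not> olt (\<pi> ^ L * (c1 x - c2 x)) (c1 x - c2 x)" using pi_power_le[of 0 L "c1 x - c2 x"] by simp
        then show False using * olt_cong(2)[OF close(2,1,3)] unfolding near2_def sd by blast
      qed
      show "\<not> (far x t \<and> near2 x t)"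
      proof
        assume *: "far x t \<and> near2 x t"
        note far = conjunct1[OF *, unfolded far_def]
        note close = far_close(1-3)[OF far L(2) \<open>0 < m2\<close>]
        show False
          using * olt_cong(2)[OF close(2,1,3)] far_not_near[OF far] unfolding near2_def sd by blast
      qed
    qed
    have "S near1 \<inter> S near2 = {}" "S near1 \<inter> S far = {}" "S near2 \<inter> S far = {}"
      "S T \<inter> S (\<lambda>x t. \<not> far x t \<and> \<not> near1 x t \<and> \<not> near2 x t) = {}"
      if "T \<in> {near1, near2, far}" for T
      by (rule S_disj; use excl that in blast)+
    note disj = this(1-3)[of far, simplified] this(4)
    from parts have "decomposable k Z (S near1 \<union> (S near2 \<union> (S far \<union>
        S (\<lambda>x t. \<not> far x t \<and> \<not> near1 x t \<and> \<not> near2 x t))))"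
      by (intro decomposable_Un) (simp_all add: Int_Un_distrib disj)
    moreover have "?C1 \<inter> ?C2 = S near1 \<union> (S near2 \<union> (S far \<union>
        S (\<lambda>x t. \<not> far x t \<and> \<not> near1 x t \<and> \<not> near2 x t)))"
      unfolding S_def W_def gcell_def by auto
    ultimately show ?thesis by simp
  qed
qed

end

theorem theorem2p1:
  fixes q :: nat
    and v :: "'k::field \<Rightarrow> 'g::linordered_ab_group_add"
    and \<pi> :: 'k
    and F :: "'f \<Rightarrow> 'k list \<Rightarrow> 'k"
    and R :: "'r \<Rightarrow> 'k list \<Rightarrow> bool"
    and \<Delta> :: "nat \<Rightarrow> ('k list \<Rightarrow> 'k) set"
    and k :: nat
    and C1 C2 :: "'k celld"
  assumes "FqZ_field q v"
    and "uniformizer v \<pi>"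
    and "expands_Ldist v \<pi> F R"
    and "order_definable_coll v F R \<Delta>"
    and "cell_ok F R \<Delta> k C1"
    and "cell_ok F R \<Delta> k C2"
  shows "\<exists>\<Delta>' :: nat \<Rightarrow> ('k list \<Rightarrow> 'k) set. order_definable_coll v F R \<Delta>' \<and>
           (\<exists>cs :: 'k celld list.
              (\<forall>C \<in> set cs. cell_ok F R \<Delta>' k C \<and> (center C = center C1 \<or> center C = center C2)) \<and>
              (\<forall>i j. i < length cs \<longrightarrow> j < length cs \<longrightarrow> i \<noteq> j \<longrightarrow>
                  cell_set v \<pi> k (cs ! i) \<inter> cell_set v \<pi> k (cs ! j) = {}) \<and>
              (\<Union>C \<in> set cs. cell_set v \<pi> k C) = cell_set v \<pi> k C1 \<inter> cell_set v \<pi> k C2)"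
proof -
  interpret dist_field q v \<pi> F R
    using assms(1-3) by unfold_locales
  obtain P1 A1 B1 l1 n1 m1 where 1: "dp k P1" "finite A1" "A1 \<subseteq> ods k" "finite B1" "B1 \<subseteq> ods k"
    "0 < n1" "0 < m1" "qf_def_fun F R k (center C1)"
    "cell_set v \<pi> k C1 = gcell k P1 A1 B1 (center C1) l1 n1 m1"
    by (rule cell_eq_gcell[OF assms(4,5)])
  obtain P2 A2 B2 l2 n2 m2 where 2: "dp k P2" "finite A2" "A2 \<subseteq> ods k" "finite B2" "B2 \<subseteq> ods k"
    "0 < n2" "0 < m2" "qf_def_fun F R k (center C2)"
    "cell_set v \<pi> k C2 = gcell k P2 A2 B2 (center C2) l2 n2 m2"
    by (rule cell_eq_gcell[OF assms(4,6)])
  have "decomposable k {center C1, center C2} (cell_set v \<pi> k C1 \<inter> cell_set v \<pi> k C2)"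
    unfolding 1(9) 2(9) by (rule decomposable_Int[OF 1(1-7) 2(1-7) 1(8) 2(8)]) simp_all
  then obtain cs where cs: "\<forall>C \<in> set cs. cell_ok F R ods k C \<and> center C \<in> {center C1, center C2}"
    "sorted_wrt (\<lambda>C C'. cell_set v \<pi> k C \<inter> cell_set v \<pi> k C' = {}) cs"
    "(\<Union>C \<in> set cs. cell_set v \<pi> k C) = cell_set v \<pi> k C1 \<inter> cell_set v \<pi> k C2"
    unfolding decomposable_def by blast
  \<comment> \<open>\<open>sorted_wrt\<close> compares earlier with later positions only, and
    disjointness is symmetric.\<close>
  have "cell_set v \<pi> k (cs ! i) \<inter> cell_set v \<pi> k (cs ! j) = {}"
    if "i < length cs" "j < length cs" "i \<noteq> j" for i j
  proof (cases "i < j")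
    case True
    then show ?thesis using cs(2) that unfolding sorted_wrt_iff_nth_less by blast
  next
    case False
    then have "j < i" using that(3) by simp
    then show ?thesis using cs(2) that unfolding sorted_wrt_iff_nth_less by blast
  qed
  \<comment> \<open>The largest admissible collection, that of all order-definable functions, serves
    as \<Delta>'.\<close>
  moreover have "order_definable_coll v F R ods"
    by (simp add: order_definable_coll_def ods_def)
  ultimately show ?thesis using cs(1,3) by (intro exI[of _ ods] conjI exI[of _ cs]) auto
qed

end
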